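(* The dual function $D(\lambda)$ is differentiable over $\mathbb R^N_+$, and its gradient is $$\nabla D(\lambda)=\begin{bmatrix}J_1(K^*_\lambda)-c_1&\cdots&J_N(K^*_\lambda)-c_N\end{bmatrix}^\top .$$
   Context: Consider the discrete-time linear system $x_{t+1}=Ax_t+Bu_t$, with state $x_t\in\mathbb R^n$, input $u_t\in\mathbb R^m$, $(A,B)$ controllable, and random initial state $x_0$ with zero mean and $\mathbb E[x_0x_0^\top]=I_n$. Let $Q_0,R_0>0$ (symmetric positive definite) and $Q_i,R_i\ge 0$ (symmetric positive semidefinite) for $i\in\{1,\dots,N\}$, where $Q_i\in\mathbb R^{n\times n}$, $R_i\in\mathbb R^{m\times m}$, and let $c_1,\dots,c_N$ be real constants. For $K\in\mathbb R^{m\times n}$ and $i\in\{0,\dots,N\}$ let $J_i(K)=\mathbb E_{x_0}\big[\sum_{t=0}^\infty (x_t^\top Q_ix_t+u_t^\top R_iu_t)\big]$ under the state feedback $u_t=-Kx_t$. Let $\rho(\cdot)$ be the spectral radius and $\mathcal S=\{K\in\mathbb R^{m\times n}:\rho(A-BK)<1\}$. For $\lambda\in\mathbb R^N_+$ (entrywise nonnegative vectors), define $\mathcal L(K,\lambda)=J_0(K)+\sum_{i=1}^N\lambda_i(J_i(K)-c_i)$ and the dual function $D(\lambda)=\min_{K\in\mathcal S}\mathcal L(K,\lambda)$. Set $Q_\lambda=Q_0+\sum_i\lambda_iQ_i$ and $R_\lambda=R_0+\sum_i\lambda_iR_i$. The unique minimizer of $\mathcal L(\cdot,\lambda)$ over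 $\mathcal S$ is $K^*_\lambda=(R_\lambda+B^\top P^*_\lambda B)^{-1}B^\top P^*_\lambda A$, where $P^*_\lambda$ is the positive definite solution of $P=A^\top PA+Q_\lambda-A^\top PB(R_\lambda+B^\top PB)^{-1}B^\top PA$. *)

theory Defs
  imports "HOL-Probability.Probability"
begin

definition pos_def :: "real^'n^'n \<Rightarrow> bool" where
  "pos_def P \<longleftrightarrow> transpose P = P \<and> (\<forall>x. x \<noteq> 0 \<longrightarrow> x \<bullet> (P *v x) > 0)"

definition pos_semidef :: "real^'n^'n \<Rightarrow> bool" where
  "pos_semidef P \<longleftrightarrow> transpose P = P \<and> (\<forall>x. x \<bullet> (P *v x) \<ge> 0)"

text \<open>Spectral radius of a real matrix: the eigenvalues are taken over the complex numbers.\<close>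

definition complex_spectrum :: "real^'n^'n \<Rightarrow> complex set" where
  "complex_spectrum A =
     {z. \<exists>v :: complex^'n. v \<noteq> 0 \<and> map_matrix complex_of_real A *v v = z *s v}"

definition matrix_spectral_radius :: "real^'n^'n \<Rightarrow> real" where
  "matrix_spectral_radius A = Max (norm ` complex_spectrum A)"

primrec traj :: "real^'n^'n \<Rightarrow> real^'m^'n \<Rightarrow> (nat \<Rightarrow> real^'m) \<Rightarrow> real^'n \<Rightarrow> nat \<Rightarrow> real^'n" where
  "traj A B u x 0 = x"
| "traj A B u x (Suc t) = A *v traj A B u x t + B *v u t"

definition controllable :: "real^'n^'n \<Rightarrow> real^'m^'n \<Rightarrow> bool" where
  "controllable A B \<longleftrightarrow> (\<forall>x y. \<exists>u T. traj A B u x T = y)"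

primrec fb_state :: "real^'n^'n \<Rightarrow> real^'m^'n \<Rightarrow> real^'n^'m \<Rightarrow> real^'n \<Rightarrow> nat \<Rightarrow> real^'n" where
  "fb_state A B K x 0 = x"
| "fb_state A B K x (Suc t) = A *v fb_state A B K x t + B *v (- (K *v fb_state A B K x t))"

definition fb_input :: "real^'n^'n \<Rightarrow> real^'m^'n \<Rightarrow> real^'n^'m \<Rightarrow> real^'n \<Rightarrow> nat \<Rightarrow> real^'m" where
  "fb_input A B K x t = - (K *v fb_state A B K x t)"

definition stabilizing :: "real^'n^'n \<Rightarrow> real^'m^'n \<Rightarrow> (real^'n^'m) set" where
  "stabilizing A B = {K. matrix_spectral_radius (A - B ** K) < 1}"

text \<open>The cost is only meaningful for stabilizing gains; elsewhere the series may diverge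
  and the real-valued sum and integral are then arbitrary.\<close>

definition lqr_cost ::
  "'w measure \<Rightarrow> ('w \<Rightarrow> real^'n) \<Rightarrow> real^'n^'n \<Rightarrow> real^'m^'n \<Rightarrow>
   real^'n^'n \<Rightarrow> real^'m^'m \<Rightarrow> real^'n^'m \<Rightarrow> real" where
  "lqr_cost M x0 A B Q R K =
     (\<integral>\<omega>. (\<Sum>t. fb_state A B K (x0 \<omega>) t \<bullet> (Q *v fb_state A B K (x0 \<omega>) t)
              + fb_input A B K (x0 \<omega>) t \<bullet> (R *v fb_input A B K (x0 \<omega>) t)) \<partial>M)"

definition lagrangian ::
  "'w measure \<Rightarrow> ('w \<Rightarrow> real^'n) \<Rightarrow> real^'n^'n \<Rightarrow> real^'m^'n \<Rightarrow> real^'n^'n \<Rightarrow> real^'m^'m \<Rightarrow>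
   ('k::finite \<Rightarrow> real^'n^'n) \<Rightarrow> ('k \<Rightarrow> real^'m^'m) \<Rightarrow> real^'k \<Rightarrow> real^'n^'m \<Rightarrow> real^'k \<Rightarrow> real" where
  "lagrangian M x0 A B Q0 R0 Q R c K l =
     lqr_cost M x0 A B Q0 R0 K + (\<Sum>i\<in>UNIV. l $ i * (lqr_cost M x0 A B (Q i) (R i) K - c $ i))"

text \<open>The dual value is the minimum over the stabilizing gains, not merely the infimum:
  \<open>LEAST\<close> is unspecified if no minimum is attained.\<close>

definition dual_function ::
  "'w measure \<Rightarrow> ('w \<Rightarrow> real^'n) \<Rightarrow> real^'n^'n \<Rightarrow> real^'m^'n \<Rightarrow> real^'n^'n \<Rightarrow> real^'m^'m \<Rightarrow>
   ('k::finite \<Rightarrow> real^'n^'n) \<Rightarrow> ('k \<Rightarrow> real^'m^'m) \<Rightarrow> real^'k \<Rightarrow> real^'k \<Rightarrow> real" where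
  "dual_function M x0 A B Q0 R0 Q R c l =
     (LEAST d. d \<in> (\<lambda>K. lagrangian M x0 A B Q0 R0 Q R c K l) ` stabilizing A B)"

text \<open>Used both for \<open>Q\<^sub>\<lambda>\<close> and for \<open>R\<^sub>\<lambda>\<close>.\<close>

definition weighted :: "real^'a^'a \<Rightarrow> ('k::finite \<Rightarrow> real^'a^'a) \<Rightarrow> real^'k \<Rightarrow> real^'a^'a" where
  "weighted W0 W l = W0 + (\<Sum>i\<in>UNIV. (l $ i) *\<^sub>R W i)"

definition riccati_solution ::
  "real^'n^'n \<Rightarrow> real^'m^'n \<Rightarrow> real^'n^'n \<Rightarrow> real^'m^'m \<Rightarrow> real^'n^'n" where
  "riccati_solution A B Q R =
     (THE P. pos_def P \<and>
        P = transpose A ** P ** A + Q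
            - transpose A ** P ** B ** matrix_inv (R + transpose B ** P ** B)
              ** transpose B ** P ** A)"

definition optimal_gain ::
  "real^'n^'n \<Rightarrow> real^'m^'n \<Rightarrow> real^'n^'n \<Rightarrow> real^'m^'m \<Rightarrow>
   ('k::finite \<Rightarrow> real^'n^'n) \<Rightarrow> ('k \<Rightarrow> real^'m^'m) \<Rightarrow> real^'k \<Rightarrow> real^'n^'m" where
  "optimal_gain A B Q0 R0 Q R l =
     (let P = riccati_solution A B (weighted Q0 Q l) (weighted R0 R l)
      in matrix_inv (weighted R0 R l + transpose B ** P ** B) ** transpose B ** P ** A)"

definition nonneg_orthant :: "(real^'k) set" where
  "nonneg_orthant = {l. \<forall>i. 0 \<le> l $ i}"

end

theory Submission
  imports Defs "HOL-Computational_Algebra.Fundamental_Theorem_Algebra"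
begin

text \<open>
Fix \<open>l\<close> and let \<open>l'\<close> be a nearby multiplier. The Lagrangian is affine in the multiplier, so
\<open>L(K\<^sub>l, l') = D(l) + \<nabla>D(l) \<bullet> (l' - l)\<close> for the claimed gradient, and differentiability means
that the gap \<open>L(K\<^sub>l, l') - D(l') \<ge> 0\<close> is \<open>o(l' - l)\<close>. Completing the square in the Riccati
equation at \<open>l'\<close> writes this gap as a sum of quadratic forms in \<open>(K\<^sub>l\<^sub>' - K\<^sub>l) x\<^sub>t\<close> along the closed
loop of \<open>K\<^sub>l\<close>. Comparing the cost of one optimal gain under the weights of the other gives
\<open>P\<^sub>l\<^sub>' \<le> (1 + \<kappa> \<bar>l' - l\<bar>) P\<^sub>l\<close> and vice versa, so \<open>P\<close> and hence \<open>K\<close> is Lipschitz at \<open>l\<close> and the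
gap is \<open>O(\<bar>l' - l\<bar>\<^sup>2)\<close>. The Riccati solution itself is the limit of value iteration, which
controllability keeps bounded; spectral radius below 1 makes orbits absolutely summable by
factoring the minimal polynomial of the closed-loop matrix.
\<close>

section \<open>Spectral radius and orbits\<close>

text \<open>This is p(F) x, evaluated by Horner's rule directly on vectors, so that no ring of
  matrix polynomials has to be set up.\<close>

definition poly_apply :: "('a::field)^'n^'n \<Rightarrow> 'a poly \<Rightarrow> 'a^'n \<Rightarrow> 'a^'n" where
  "poly_apply F p x = fold_coeffs (\<lambda>a y. a *s x + F *v y) p 0"

lemma poly_apply_0 [simp]: "poly_apply F 0 x = 0"
  by (simp add: poly_apply_def)

lemma poly_apply_pCons [simp]: "poly_apply F (pCons a p) x = a *s x + F *v poly_apply F p x"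
  by (cases "a = 0"; cases "p = 0") (auto simp: poly_apply_def)

lemma poly_apply_add: "poly_apply F (p + q) x = poly_apply F p x + poly_apply F q x"
  by (induction p q rule: poly_induct2) (auto simp: algebra_simps vec.add vector_sadd_rdistrib)

lemma poly_apply_smult: "poly_apply F (smult a p) x = a *s poly_apply F p x"
  by (induction p) (auto simp: vec.scale vector_add_ldistrib vector_smult_assoc)

lemma poly_apply_sum: "poly_apply F (sum f S) x = (\<Sum>i\<in>S. poly_apply F (f i) x)"
  by (induction S rule: infinite_finite_induct) (auto simp: poly_apply_add)

lemma poly_apply_monom: "poly_apply F (monom a n) x = a *s ((*v) F ^^ n) x"
proof (induction n)
  case 0
  show ?case by (simp add: monom_0)
next
  case (Suc n)
  have "poly_apply F (monom a (Suc n)) x = F *v poly_apply F (monom a n) x"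
    by (simp add: monom_Suc)
  then show ?case by (simp add: Suc vec.scale)
qed

lemma poly_apply_mult_linear:
  "poly_apply F ([:- z, 1:] * q) x = F *v poly_apply F q x - z *s poly_apply F q x"
proof -
  have "[:- z, 1:] * q = smult (- z) q + pCons 0 q"
    by (simp add: mult_pCons_left)
  then show ?thesis
    by (simp only: poly_apply_add poly_apply_smult poly_apply_pCons) simp
qed

lemma poly_apply_eigenvector:
  assumes "F *v v = z *s v"
  shows "poly_apply F p v = poly p z *s v"
  by (induction p) (auto simp: vec.scale assms vector_smult_assoc vector_sadd_rdistrib mult.commute)

text \<open>Among one more vector than the dimension there is a linear relation. Dependence is a
  property of sets, so repeated terms are treated apart: a repetition yields the coefficients 1 and
  -1.\<close>

lemma real_dependence_of_sequence:
  fixes G :: "nat \<Rightarrow> 'a::euclidean_space"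
  shows "\<exists>n c. (\<exists>i\<le>n. c i \<noteq> 0) \<and> (\<Sum>i\<le>n. c i *\<^sub>R G i) = 0"
proof (cases "inj_on G {..DIM('a)}")
  case True
  let ?S = "G ` {..DIM('a)}"
  have "card ?S > DIM('a)"
    using True by (simp add: card_image)
  then have "dependent ?S"
    using independent_bound by fastforce
  then obtain u where u: "\<exists>v\<in>?S. u v \<noteq> 0" "(\<Sum>v\<in>?S. u v *\<^sub>R v) = 0"
    by (auto simp: dependent_finite)
  have "(\<Sum>i\<le>DIM('a). u (G i) *\<^sub>R G i) = 0"
    using u(2) True by (simp add: sum.reindex)
  then show ?thesis
    using u(1) by (intro exI[of _ "DIM('a)"] exI[of _ "\<lambda>i. u (G i)"]) auto
next
  case False
  then obtain i j where ij: "G i = G j" "i < j"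
    by (metis inj_onI linorder_neqE_nat)
  have "(\<Sum>k\<le>j. (if k = i then 1 else if k = j then - 1 else 0 :: real) *\<^sub>R G k)
      = (\<Sum>k\<in>{i,j}. (if k = i then 1 else if k = j then - 1 else 0 :: real) *\<^sub>R G k)"
    using ij by (intro sum.mono_neutral_right) auto
  also have "\<dots> = 0"
    using ij by auto
  finally show ?thesis
    using ij by (intro exI[of _ j] exI[of _ "\<lambda>k. if k = i then 1 else if k = j then - 1 else 0"]) auto
qed

lemma scaleR_eq_vector_smult: "c *\<^sub>R (v :: complex^'n) = complex_of_real c *s v"
  by (simp add: vec_eq_iff) (simp add: scaleR_conv_of_real)

lemma scaleR_matrix_vector_smult: "(c *\<^sub>R F) *v x = c *\<^sub>R (F *v (x :: complex^'n))"
  by (simp add: vec_eq_iff matrix_vector_mult_def scaleR_right.sum)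

text \<open>Complex matrices form a finite-dimensional real space, so the powers of \<open>F\<close>
  satisfy a linear relation, even with real coefficients; its coefficients are those of
  \<open>p\<close>.\<close>

lemma annihilating_poly_exists:
  fixes F :: "complex^'n^'n"
  shows "\<exists>p. p \<noteq> 0 \<and> (\<forall>x. poly_apply F p x = 0)"
proof -
  define G where "G i = ((**) F ^^ i) (mat 1)" for i
  have G: "G i *v x = ((*v) F ^^ i) x" for i x
    by (induction i) (auto simp: G_def matrix_vector_mul_assoc[symmetric])
  obtain n c where nc: "\<exists>i\<le>n. c i \<noteq> 0" "(\<Sum>i\<le>n. c i *\<^sub>R G i) = 0"
    using real_dependence_of_sequence[of G] by blast
  define p where "p = (\<Sum>i\<le>n. monom (complex_of_real (c i)) i)"
  have "coeff p i = complex_of_real (c i)" if "i \<le> n" for i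
    using that by (simp add: p_def coeff_sum if_distrib cong: if_cong)
  then have "p \<noteq> 0"
    using nc(1) by (metis coeff_0 of_real_eq_0_iff)
  moreover have "poly_apply F p x = 0" for x
  proof -
    have "poly_apply F p x = (\<Sum>i\<le>n. c i *\<^sub>R (G i *v x))"
      by (simp add: p_def poly_apply_sum poly_apply_monom G scaleR_eq_vector_smult)
    also have "\<dots> = (\<Sum>i\<le>n. c i *\<^sub>R G i) *v x"
      by (induction n) (simp_all only: atMost_0 sum.insert sum.empty finite.emptyI empty_iff not_False_eq_True add_0_right sum.atMost_Suc matrix_vector_mult_add_rdistrib
          scaleR_matrix_vector_smult)
    finally show ?thesis by (simp add: nc(2))
  qed
  ultimately show ?thesis by blast
qed

text \<open>Take \<open>p\<close> of least degree among the nonzero annihilating polynomials. If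
  \<open>p = [:- z, 1:] * q\<close>, minimality yields \<open>x\<close> with q(F) x nonzero, and
  this vector is an eigenvector for \<open>z\<close>. Conversely p(F) v = p(z) v for an eigenvector
  \<open>v\<close>.\<close>

lemma minimal_poly_roots_eigenvalues:
  fixes F :: "complex^'n^'n"
  obtains p where "p \<noteq> 0" "\<And>x. poly_apply F p x = 0"
    "{z. poly p z = 0} = {z. \<exists>v. v \<noteq> 0 \<and> F *v v = z *s v}"
proof -
  define p where "p = (ARG_MIN degree p. p \<noteq> 0 \<and> (\<forall>x. poly_apply F p x = 0))"
  have p: "p \<noteq> 0 \<and> (\<forall>x. poly_apply F p x = 0)"
  proof -
    obtain q where "q \<noteq> 0 \<and> (\<forall>x. poly_apply F q x = 0)"
      using annihilating_poly_exists[of F] by (rule exE)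
    then show ?thesis
      unfolding p_def by (rule arg_min_natI)
  qed
  have min: "degree p \<le> degree q" if "q \<noteq> 0" "\<And>x. poly_apply F q x = 0" for q
    unfolding p_def using that by (intro arg_min_nat_le) auto
  have "\<exists>v. v \<noteq> 0 \<and> F *v v = z *s v" if z: "poly p z = 0" for z
  proof -
    obtain q where q: "p = [:- z, 1:] * q"
      using z by (auto simp: poly_eq_0_iff_dvd elim: dvdE)
    have "q \<noteq> 0"
      using p q by auto
    then have "degree p = Suc (degree q)"
      unfolding q by (subst degree_mult_eq) auto
    then obtain x where "poly_apply F q x \<noteq> 0"
      using min[of q] \<open>q \<noteq> 0\<close> by fastforce
    moreover have "F *v poly_apply F q x = z *s poly_apply F q x"
      using p poly_apply_mult_linear[of F z q x] by (simp only: q) simp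
    ultimately show ?thesis by blast
  qed
  moreover have "poly p z = 0" if "v \<noteq> 0" "F *v v = z *s v" for v z
    using p poly_apply_eigenvector[OF that(2), of p] that(1) by auto
  ultimately show ?thesis
    using p that[of p] by blast
qed

text \<open>The spectral radius is defined by \<open>Max\<close>, which is meaningful only on finite
  nonempty sets. Both properties are read off the roots of the minimal polynomial.\<close>

lemma eigenvalues_finite_nonempty:
  fixes F :: "complex^'n^'n"
  shows "finite {z. \<exists>v. v \<noteq> 0 \<and> F *v v = z *s v}" "{z. \<exists>v. v \<noteq> 0 \<and> F *v v = z *s v} \<noteq> {}"
proof -
  obtain p where p: "p \<noteq> 0" "\<And>x. poly_apply F p x = 0"
    "{z. poly p z = 0} = {z. \<exists>v. v \<noteq> 0 \<and> F *v v = z *s v}"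
    using minimal_poly_roots_eigenvalues[of F] by blast
  show "finite {z. \<exists>v. v \<noteq> 0 \<and> F *v v = z *s v}"
    using poly_roots_finite[OF p(1)] by (simp add: p(3))
  have "degree p \<noteq> 0"
  proof
    assume "degree p = 0"
    then obtain a where a: "p = [:a:]"
      by (rule degree_eq_zeroE)
    \<comment> \<open>A constant annihilating polynomial is tested on the all-ones vector, which
      forces the constant to be 0.\<close>
    then have "a *s (1 :: complex^'n) = 0"
      using p(2)[of 1] by simp
    then show False
      using a p(1) by (simp add: vec_eq_iff)
  qed
  then have "\<exists>z. poly p z = 0"
    using fundamental_theorem_of_algebra constant_degree by metis
  then show "{z. \<exists>v. v \<noteq> 0 \<and> F *v v = z *s v} \<noteq> {}"
    using p(3) by blast
qed

lemma spectral_radius_less_iff: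
  fixes F :: "real^'n^'n"
  shows "matrix_spectral_radius F < r \<longleftrightarrow>
    (\<forall>z v. v \<noteq> 0 \<longrightarrow> map_matrix complex_of_real F *v v = z *s v \<longrightarrow> norm z < r)"
proof -
  have "finite (complex_spectrum F)" "complex_spectrum F \<noteq> {}"
    unfolding complex_spectrum_def using eigenvalues_finite_nonempty by blast+
  then have "matrix_spectral_radius F < r \<longleftrightarrow> (\<forall>z\<in>complex_spectrum F. norm z < r)"
    unfolding matrix_spectral_radius_def by (subst Max_less_iff) auto
  then show ?thesis
    unfolding complex_spectrum_def by blast
qed

section \<open>Absolute summability of orbits\<close>

lemma funpow_matrix_mult_diff:
  "((*v) F ^^ t) (F *v x - z *s x) = ((*v) F ^^ Suc t) x - z *s ((*v) F ^^ t) (x :: complex^'n)"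
proof (induction t)
  case 0
  show ?case by simp
next
  case (Suc t)
  then show ?case
    by (simp only: funpow.simps o_apply vec.diff vec.scale)
qed

lemma norm_vector_smult: "norm (z *s (x :: complex^'n)) = norm z * norm x"
  by (simp add: norm_vec_def norm_mult L2_set_right_distrib)

text \<open>The recursion \<open>a (t+1) = z * a t + b t\<close> with \<open>norm z < 1\<close> and absolutely summable \<open>b\<close>
  bounds the partial sums \<open>s\<close> of \<open>norm (a t)\<close> by \<open>s \<le> norm (a 0) + norm z * s + B\<close>.\<close>

lemma summable_orbit_factor:
  fixes F :: "complex^'n^'n"
  assumes z: "norm z < 1" and sb: "summable (\<lambda>t. norm (((*v) F ^^ t) (F *v x - z *s x)))"
  shows "summable (\<lambda>t. norm (((*v) F ^^ t) x))"
proof (rule bounded_imp_summable)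
  let ?a = "\<lambda>t. ((*v) F ^^ t) x" and ?b = "\<lambda>t. ((*v) F ^^ t) (F *v x - z *s x)"
  let ?B = "\<Sum>t. norm (?b t)"
  fix n
  have step: "norm (?a (Suc t)) \<le> norm z * norm (?a t) + norm (?b t)" for t
    using norm_triangle_ineq[of "z *s ?a t" "?b t"]
    by (simp add: funpow_matrix_mult_diff norm_vector_smult)
  have "(\<Sum>t\<le>n. norm (?a t)) \<le> (\<Sum>t\<le>Suc n. norm (?a t))"
    by simp
  also have "\<dots> = norm x + (\<Sum>t\<le>n. norm (?a (Suc t)))"
    by (subst sum.atMost_Suc_shift) simp
  also have "\<dots> \<le> norm x + (\<Sum>t\<le>n. norm z * norm (?a t) + norm (?b t))"
    by (intro add_left_mono sum_mono step)
  also have "\<dots> = norm x + norm z * (\<Sum>t\<le>n. norm (?a t)) + (\<Sum>t\<le>n. norm (?b t))"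
    by (simp add: sum.distrib sum_distrib_left)
  also have "(\<Sum>t\<le>n. norm (?b t)) \<le> ?B"
    by (intro sum_le_suminf sb) auto
  finally have "(\<Sum>t\<le>n. norm (?a t)) * (1 - norm z) \<le> norm x + ?B"
    by (simp add: algebra_simps)
  then show "(\<Sum>t\<le>n. norm (?a t)) \<le> (norm x + ?B) / (1 - norm z)"
    using z by (simp add: pos_le_divide_eq)
qed auto

text \<open>The linear factors of \<open>p\<close> are peeled off one at a time:
  \<open>summable_orbit_factor\<close> passes from the orbit of (F - z) q(F) x to that of q(F) x,
  until only a nonzero constant is left.\<close>

lemma summable_orbit_poly:
  fixes F :: "complex^'n^'n"
  assumes "p \<noteq> 0" "\<And>z. poly p z = 0 \<Longrightarrow> norm z < 1"
    "summable (\<lambda>t. norm (((*v) F ^^ t) (poly_apply F p x)))"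
  shows "summable (\<lambda>t. norm (((*v) F ^^ t) x))"
  using assms
proof (induction "degree p" arbitrary: p)
  case 0
  then obtain a where a: "p = [:a:]" "a \<noteq> 0"
    by (metis degree_eq_zeroE pCons_eq_0_iff)
  have "((*v) F ^^ t) (a *s x) = a *s ((*v) F ^^ t) x" for t
    by (induction t) (auto simp: vec.scale)
  then have "summable (\<lambda>t. norm a * norm (((*v) F ^^ t) x))"
    using 0(4) a by (simp add: norm_vector_smult)
  then show ?case
    using a(2) by (simp add: summable_cmult_iff)
next
  case (Suc n)
  then obtain z where z: "poly p z = 0"
    using fundamental_theorem_of_algebra constant_degree by (metis nat.distinct(1))
  then obtain q where q: "p = [:- z, 1:] * q"
    by (auto simp: poly_eq_0_iff_dvd elim: dvdE)
  have "q \<noteq> 0"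
    using Suc.prems(1) q by auto
  then have "n = degree q"
    using Suc.hyps(2) unfolding q by (subst (asm) degree_mult_eq) auto
  moreover have "summable (\<lambda>t. norm (((*v) F ^^ t) (poly_apply F q x)))"
    using Suc.prems(2)[OF z] Suc.prems(3) unfolding q poly_apply_mult_linear
    by (rule summable_orbit_factor)
  moreover have "norm w < 1" if "poly q w = 0" for w
    using Suc.prems(2)[of w] that by (simp add: q)
  ultimately show ?case
    by (intro Suc.hyps(1)[of q] \<open>q \<noteq> 0\<close>)
qed

text \<open>For the minimal polynomial p(F) x = 0, so the premise of
  \<open>summable_orbit_poly\<close> is trivial. The embedding \<open>C\<close> of real into complex
  vectors is isometric and commutes with the matrix, which carries the result back.\<close>

lemma summable_norm_orbit:
  fixes F :: "real^'n^'n"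
  assumes "matrix_spectral_radius F < 1"
  shows "summable (\<lambda>t. norm (((*v) F ^^ t) x))"
proof -
  let ?F = "map_matrix complex_of_real F"
  define C :: "real^'n \<Rightarrow> complex^'n" where "C v = (\<chi> i. complex_of_real (v $ i))" for v
  have F: "?F *v C v = C (F *v v)" for v
    by (simp add: C_def vec_eq_iff matrix_vector_mult_def)
  have orbit: "((*v) ?F ^^ t) (C x) = C (((*v) F ^^ t) x)" for t
    by (induction t) (auto simp: F)
  have norm_C: "norm (C v) = norm v" for v
    by (simp add: C_def norm_vec_def)
  obtain p where p: "p \<noteq> 0" "\<And>x. poly_apply ?F p x = 0"
    "{z. poly p z = 0} = {z. \<exists>v. v \<noteq> 0 \<and> ?F *v v = z *s v}"
    using minimal_poly_roots_eigenvalues[of ?F] by blast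
  have "((*v) ?F ^^ t) 0 = 0" for t
    by (induction t) auto
  then have "summable (\<lambda>t. norm (((*v) ?F ^^ t) (poly_apply ?F p (C x))))"
    by (simp add: p(2))
  moreover have "norm z < 1" if "poly p z = 0" for z
    using assms p(3) that unfolding spectral_radius_less_iff by blast
  ultimately have "summable (\<lambda>t. norm (((*v) ?F ^^ t) (C x)))"
    using summable_orbit_poly[OF p(1)] by blast
  then show ?thesis
    by (simp add: orbit norm_C)
qed

section \<open>Quadratic forms\<close>

text \<open>As simp rules these move transposes to the other side of the vector; below,
  \<open>transpose B *v y\<close> has to survive until \<open>inner_transpose\<close> shifts it
  across an inner product.\<close>

declare transpose_matrix_vector [simp del] vector_transpose_matrix [simp del]

definition quad :: "real^'n^'n \<Rightarrow> real^'n \<Rightarrow> real" where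
  "quad P x = x \<bullet> (P *v x)"

lemma quad_0 [simp]: "quad 0 x = 0" "quad P 0 = 0"
  by (simp_all add: quad_def)

lemma quad_minus [simp]: "quad P (- x) = quad P x"
  by (simp add: quad_def vec.neg)

lemma quad_add: "quad (P + P') x = quad P x + quad P' x"
  by (simp add: quad_def matrix_vector_mult_add_rdistrib inner_add_right)

lemma quad_diff: "quad (P - P') x = quad P x - quad P' x"
  by (simp add: quad_def matrix_vector_mult_diff_rdistrib inner_diff_right)

lemma quad_scaleR: "quad (c *\<^sub>R P) x = c * quad P x"
  by (simp add: quad_def scaleR_matrix_vector_assoc[symmetric])

lemma quad_sum: "quad (sum f S) x = (\<Sum>i\<in>S. quad (f i) x)"
  by (induction S rule: infinite_finite_induct) (auto simp: quad_add)

lemma inner_transpose: "x \<bullet> (transpose A *v y) = (A *v x) \<bullet> (y :: real^'n)"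
  by (metis dot_lmul_matrix inner_commute transpose_matrix_vector)

lemma symmetric_matrix_iff:
  "transpose P = P \<longleftrightarrow> (\<forall>x y. x \<bullet> (P *v y) = y \<bullet> (P *v (x :: real^'n)))"
proof
  assume "transpose P = P"
  then show "\<forall>x y. x \<bullet> (P *v y) = y \<bullet> (P *v x)"
    by (metis inner_transpose inner_commute)
next
  assume s: "\<forall>x y. x \<bullet> (P *v y) = y \<bullet> (P *v x)"
  have "transpose P *v y = P *v y" for y
    by (rule vector_eq_ldot[THEN iffD1]) (use s in \<open>auto simp: inner_transpose inner_commute\<close>)
  then show "transpose P = P"
    by (simp add: matrix_eq)
qed

lemma quad_plus:
  assumes "transpose P = P"
  shows "quad P (x + y) = quad P x + 2 * (x \<bullet> (P *v y)) + quad P y"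
  using assms unfolding symmetric_matrix_iff
  by (simp add: quad_def matrix_vector_right_distrib inner_add_left inner_add_right)

lemma quad_congruence: "quad (transpose B ** P ** B) x = quad P (B *v x)"
  by (simp add: quad_def matrix_vector_mul_assoc[symmetric] inner_transpose)

section \<open>Two-sided bounds for quadratic forms\<close>

lemma quad_upper_bound: "\<exists>c\<ge>0. \<forall>x. \<bar>quad P x\<bar> \<le> c * (x \<bullet> x)"
proof -
  have "\<bar>quad P x\<bar> \<le> onorm ((*v) P) * (x \<bullet> x)" for x
  proof -
    have "\<bar>quad P x\<bar> \<le> norm x * norm (P *v x)"
      unfolding quad_def by (rule Cauchy_Schwarz_ineq2)
    also have "\<dots> \<le> norm x * (onorm ((*v) P) * norm x)"
      by (intro mult_left_mono onorm) auto
    finally show ?thesis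
      by (simp add: dot_square_norm power2_eq_square algebra_simps)
  qed
  moreover have "0 \<le> onorm ((*v) P)"
    by (intro onorm_pos_le) auto
  ultimately show ?thesis by blast
qed

lemma pos_defD:
  assumes "pos_def P"
  shows "transpose P = P" "x \<noteq> 0 \<Longrightarrow> quad P x > 0" "quad P x \<ge> 0"
  using assms by (auto simp: pos_def_def quad_def) (metis inner_zero_left less_eq_real_def)

lemma pos_semidefD:
  assumes "pos_semidef P"
  shows "transpose P = P" "quad P x \<ge> 0"
  using assms by (auto simp: pos_semidef_def quad_def)

text \<open>The form attains a minimum on the compact unit sphere, positive by definiteness;
  homogeneity of degree 2 extends the bound to all vectors.\<close>

lemma quad_lower_bound:
  fixes P :: "real^'n^'n"
  assumes "pos_def P"
  shows "\<exists>r>0. \<forall>x. r * (x \<bullet> x) \<le> quad P x"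
proof -
  have ne: "sphere (0::real^'n) 1 \<noteq> {}"
    by (metis vector_choose_size zero_le_one mem_sphere_0 empty_iff)
  have "continuous_on (sphere 0 1) (quad P)"
    unfolding quad_def by (intro continuous_intros linear_continuous_on) auto
  then obtain s where s: "s \<in> sphere 0 1" "\<forall>y\<in>sphere 0 1. quad P s \<le> quad P y"
    using continuous_attains_inf[OF compact_sphere ne] by blast
  have "s \<noteq> 0"
    using s(1) by auto
  then have "quad P s > 0"
    using assms pos_defD by blast
  moreover have "quad P s * (x \<bullet> x) \<le> quad P x" for x
  proof (cases "x = 0")
    case False
    define y where "y = x /\<^sub>R norm x"
    have "quad P s \<le> quad P y"
      using s(2) False by (simp add: y_def)
    also have "quad P y = quad P x / (x \<bullet> x)"
      by (simp add: y_def quad_def matrix_vector_mult_scaleR dot_square_norm power2_eq_square divide_inverse)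
    finally show ?thesis
      using False by (simp add: pos_le_divide_eq)
  qed simp
  ultimately show ?thesis by blast
qed

lemma quad_dominated:
  assumes "pos_def P"
  shows "\<exists>\<theta>\<ge>0. \<forall>x. quad W x \<le> \<theta> * quad P x"
proof -
  obtain r where r: "r > 0" "\<And>x. r * (x \<bullet> x) \<le> quad P x"
    using quad_lower_bound[OF assms] by blast
  obtain c where c: "c \<ge> 0" "\<And>x. \<bar>quad W x\<bar> \<le> c * (x \<bullet> x)"
    using quad_upper_bound[of W] by blast
  have "quad W x \<le> c / r * quad P x" for x
  proof -
    have "quad W x \<le> c * (x \<bullet> x)"
      using c(2)[of x] by linarith
    also have "\<dots> = c / r * (r * (x \<bullet> x))"
      using r(1) by simp
    also have "\<dots> \<le> c / r * quad P x"
      using r c(1) by (intro mult_left_mono) auto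
    finally show ?thesis .
  qed
  then show ?thesis
    using r(1) c(1) by (intro exI[of _ "c / r"]) auto
qed

text \<open>Polarization, applied to \<open>x\<close> and the rescaling of \<open>D *v x\<close> to the length of \<open>x\<close>.\<close>

lemma norm_symmetric_matrix_le:
  assumes D: "transpose D = D" and b: "\<And>x. \<bar>quad D x\<bar> \<le> c * (x \<bullet> x)"
  shows "norm (D *v x) \<le> c * norm x"
proof (cases "D *v x = 0 \<or> x = 0")
  case True
  have "0 \<le> c * (x \<bullet> x)"
    using b[of x] by linarith
  then have "0 \<le> c * norm x"
    by (cases "x = 0") (auto simp: dot_square_norm zero_le_mult_iff)
  then show ?thesis
    using True by auto
next
  case False
  define y where "y = (norm x / norm (D *v x)) *\<^sub>R (D *v x)"
  have ny: "norm y = norm x"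
    using False by (simp add: y_def)
  have "y \<bullet> (D *v x) = norm x * norm (D *v x)"
    using False by (simp add: y_def dot_square_norm power2_eq_square)
  moreover have "4 * (y \<bullet> (D *v x)) = quad D (y + x) - quad D (y + - x)"
    by (simp only: quad_plus[OF D]) (simp add: vec.neg)
  moreover have "quad D (y + x) - quad D (y + - x) \<le> c * ((y + x) \<bullet> (y + x)) + c * ((y + - x) \<bullet> (y + - x))"
    using b[of "y + x"] b[of "y + - x"] by linarith
  moreover have "c * ((y + x) \<bullet> (y + x)) + c * ((y + - x) \<bullet> (y + - x)) = 2 * c * (y \<bullet> y + x \<bullet> x)"
    by (simp add: algebra_simps inner_commute)
  ultimately have "norm x * norm (D *v x) \<le> norm x * (c * norm x)"
    by (simp add: dot_square_norm ny power2_eq_square algebra_simps)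
  then show ?thesis
    using False by simp
qed

lemma pos_def_matrix_inv:
  fixes S :: "real^'n^'n"
  assumes "pos_def S"
  shows "S ** matrix_inv S = mat 1"
proof -
  have "x = 0" if "S *v x = 0" for x
    using pos_defD(2)[OF assms, of x] that by (auto simp: quad_def)
  then have "invertible S"
    by (simp add: invertible_left_inverse matrix_left_invertible_ker)
  then show ?thesis
    unfolding invertible_def matrix_inv_def
    by (metis (mono_tags, lifting) someI_ex)
qed

text \<open>If \<open>a\<close> and \<open>b\<close> are the real and imaginary parts of a complex eigenvector for \<open>z\<close>, then
  \<open>quad P (F a) + quad P (F b) = norm z ^ 2 * (quad P a + quad P b)\<close>.\<close>

lemma lyapunov_spectral_radius:
  fixes F :: "real^'n^'n"
  assumes P: "pos_def P" and dec: "\<And>x. x \<noteq> 0 \<Longrightarrow> quad P (F *v x) < quad P x"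
  shows "matrix_spectral_radius F < 1"
  unfolding spectral_radius_less_iff
proof (intro allI impI)
  fix z and v :: "complex^'n"
  assume v: "v \<noteq> 0" and ev: "map_matrix complex_of_real F *v v = z *s v"
  define a b where "a = (\<chi> i. Re (v $ i))" and "b = (\<chi> i. Im (v $ i))"
  have Fa: "F *v a = Re z *\<^sub>R a + (- Im z) *\<^sub>R b"
  proof (subst vec_eq_iff, intro allI)
    fix i
    have "Re ((map_matrix complex_of_real F *v v) $ i) = Re ((z *s v) $ i)"
      by (simp add: ev)
    then show "(F *v a) $ i = (Re z *\<^sub>R a + (- Im z) *\<^sub>R b) $ i"
      by (simp add: matrix_vector_mult_def a_def b_def)
  qed
  have Fb: "F *v b = Im z *\<^sub>R a + Re z *\<^sub>R b"
  proof (subst vec_eq_iff, intro allI)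
    fix i
    have "Im ((map_matrix complex_of_real F *v v) $ i) = Im ((z *s v) $ i)"
      by (simp add: ev)
    then show "(F *v b) $ i = (Im z *\<^sub>R a + Re z *\<^sub>R b) $ i"
      by (simp add: matrix_vector_mult_def a_def b_def)
  qed
  have quad_scale: "quad P (c *\<^sub>R x) = c\<^sup>2 * quad P x" for c x
    by (simp add: quad_def matrix_vector_mult_scaleR power2_eq_square)
  have "quad P (F *v a) + quad P (F *v b) = (norm z)\<^sup>2 * (quad P a + quad P b)"
    unfolding Fa Fb quad_plus[OF pos_defD(1)[OF P]] cmod_power2
    by (simp add: quad_scale matrix_vector_mult_scaleR vec.neg algebra_simps)
  moreover have "quad P (F *v x) \<le> quad P x" for x
    using dec[of x] by (cases "x = 0") auto
  moreover have ab: "a \<noteq> 0 \<or> b \<noteq> 0"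
    using v by (auto simp: a_def b_def vec_eq_iff complex_eq_iff)
  ultimately have "(norm z)\<^sup>2 * (quad P a + quad P b) < 1 * (quad P a + quad P b)"
    using dec[of a] dec[of b] by (smt (verit, ccfv_threshold))
  moreover have "quad P a + quad P b > 0"
    using ab pos_defD(2,3)[OF P] by (metis add_nonneg_pos add_pos_nonneg)
  ultimately have "(norm z)\<^sup>2 < 1"
    by (simp add: mult_less_cancel_right_pos)
  then show "norm z < 1"
    by (simp add: power_less_one_iff abs_square_less_1)
qed

section \<open>The Riccati map\<close>

text \<open>For any \<open>P\<close>, the input \<open>- (gain A B R P *v x)\<close> minimizes one
  stage cost plus the terminal cost \<open>quad P\<close>. Allowing \<open>P\<close> that do not
  solve the Riccati equation covers the value iterates as well.\<close>

definition gain :: "real^'n^'n \<Rightarrow> real^'m^'n \<Rightarrow> real^'m^'m \<Rightarrow> real^'n^'n \<Rightarrow> real^'n^'m" where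
  "gain A B R P = matrix_inv (R + transpose B ** P ** B) ** transpose B ** P ** A"

text \<open>The Bellman operator on quadratic value functions; its fixed points are the solutions of
  the algebraic Riccati equation.\<close>

definition riccati_map ::
  "real^'n^'n \<Rightarrow> real^'m^'n \<Rightarrow> real^'n^'n \<Rightarrow> real^'m^'m \<Rightarrow> real^'n^'n \<Rightarrow> real^'n^'n" where
  "riccati_map A B Q R P = transpose A ** P ** A + Q
     - transpose A ** P ** B ** matrix_inv (R + transpose B ** P ** B) ** transpose B ** P ** A"

lemma pos_def_input_weight:
  fixes R :: "real^'a^'a"
  assumes "pos_def R" "pos_semidef P"
  shows "pos_def (R + transpose B ** P ** B)"
proof -
  have "transpose (R + W) = transpose R + transpose W" for W :: "real^'a^'a"
    by (simp add: transpose_def vec_eq_iff)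
  then have "transpose (R + transpose B ** P ** B) = R + transpose B ** P ** B"
    using pos_defD(1)[OF assms(1)] pos_semidefD(1)[OF assms(2)]
    by (simp add: matrix_transpose_mul matrix_mul_assoc)
  moreover have "quad (R + transpose B ** P ** B) x > 0" if "x \<noteq> 0" for x
    using pos_defD(2)[OF assms(1) that] pos_semidefD(2)[OF assms(2), of "B *v x"]
    by (simp add: quad_add quad_congruence)
  ultimately show ?thesis
    by (simp add: pos_def_def quad_def)
qed

text \<open>The normal equation of the one-step minimization; it removes the matrix inverse from the
  arguments about gains.\<close>

lemma gain_equation:
  assumes "pos_def R" "pos_semidef P"
  shows "(R + transpose B ** P ** B) *v (gain A B R P *v x) = transpose B *v (P *v (A *v x))"
  using pos_def_matrix_inv[OF pos_def_input_weight[OF assms]]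
  by (simp add: gain_def matrix_vector_mul_assoc matrix_mul_assoc)

lemma riccati_map_apply:
  "riccati_map A B Q R P *v x =
    transpose A *v (P *v (A *v x)) + Q *v x - transpose A *v (P *v (B *v (gain A B R P *v x)))"
  by (simp add: riccati_map_def gain_def algebra_simps matrix_vector_mul_assoc matrix_mul_assoc)

text \<open>The left side is a quadratic polynomial in \<open>u\<close> with leading form
  \<open>R + transpose B ** P ** B\<close>; by the normal equation its cross term is that of the
  square centred at minus the gain, and what remains is the Riccati map.\<close>

lemma riccati_map_complete_square:
  assumes R: "pos_def R" and P: "pos_semidef P"
  shows "quad Q x + quad R u + quad P (A *v x + B *v u) =
    quad (riccati_map A B Q R P) x + quad (R + transpose B ** P ** B) (u + gain A B R P *v x)"
proof -
  let ?S = "R + transpose B ** P ** B" and ?k = "gain A B R P *v x"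
  note symP = pos_semidefD(1)[OF P] and symS = pos_defD(1)[OF pos_def_input_weight[OF R P]]
  have S: "w \<bullet> (?S *v ?k) = (B *v w) \<bullet> (P *v (A *v x))" for w
    by (simp add: gain_equation[OF R P] inner_transpose)
  have comm: "y \<bullet> (P *v w) = w \<bullet> (P *v y)" for y w
    using symP unfolding symmetric_matrix_iff by blast
  have "quad (riccati_map A B Q R P) x = quad P (A *v x) + quad Q x - ?k \<bullet> (?S *v ?k)"
    unfolding S using comm[of "A *v x" "B *v ?k"]
    by (simp add: quad_def riccati_map_apply algebra_simps inner_transpose)
  moreover have "quad R ?k + quad P (B *v ?k) = ?k \<bullet> (?S *v ?k)"
    using quad_add[of R "transpose B ** P ** B" ?k] unfolding quad_congruence by (simp add: quad_def)
  ultimately show ?thesis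
    unfolding quad_plus[OF symP] quad_plus[OF symS] S
    using comm[of "A *v x" "B *v u"] by (simp add: quad_add quad_congruence)
qed

lemma quad_riccati_map_le:
  assumes "pos_def R" "pos_semidef P"
  shows "quad (riccati_map A B Q R P) x \<le> quad Q x + quad R u + quad P (A *v x + B *v u)"
  using riccati_map_complete_square[OF assms, of Q x u A B]
    pos_defD(3)[OF pos_def_input_weight[OF assms], of B "u + gain A B R P *v x"] by linarith

lemma quad_riccati_map_eq:
  assumes "pos_def R" "pos_semidef P"
  shows "quad (riccati_map A B Q R P) x = quad Q x + quad R (gain A B R P *v x)
    + quad P (A *v x + B *v (- (gain A B R P *v x)))"
  using riccati_map_complete_square[OF assms, of Q x "- (gain A B R P *v x)" A B] by simp

text \<open>Symmetry is seen on the bilinear form, a combination of three symmetric terms.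
  Nonnegativity comes from \<open>quad_riccati_map_eq\<close>, which replaces the difference in the
  definition by a sum of nonnegative costs.\<close>

lemma pos_semidef_riccati_map:
  assumes Q: "pos_semidef Q" and R: "pos_def R" and P: "pos_semidef P"
  shows "pos_semidef (riccati_map A B Q R P)"
proof -
  let ?S = "R + transpose B ** P ** B" and ?K = "gain A B R P"
  have comm: "y \<bullet> (W *v w) = w \<bullet> (W *v y)" if "transpose W = W" for y w and W :: "real^'c^'c"
    using that unfolding symmetric_matrix_iff by blast
  have "x \<bullet> (riccati_map A B Q R P *v y) =
      (A *v x) \<bullet> (P *v (A *v y)) + x \<bullet> (Q *v y) - (?K *v x) \<bullet> (?S *v (?K *v y))" for x y
  proof -
    have "(A *v x) \<bullet> (P *v (B *v (?K *v y))) = (?K *v y) \<bullet> (?S *v (?K *v x))"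
      using comm[OF pos_semidefD(1)[OF P], of "A *v x" "B *v (?K *v y)"]
      by (simp add: gain_equation[OF R P] inner_transpose)
    also have "\<dots> = (?K *v x) \<bullet> (?S *v (?K *v y))"
      by (rule comm[OF pos_defD(1)[OF pos_def_input_weight[OF R P]]])
    finally show ?thesis
      by (simp add: riccati_map_apply inner_transpose inner_diff_right inner_add_right)
  qed
  then have "transpose (riccati_map A B Q R P) = riccati_map A B Q R P"
    unfolding symmetric_matrix_iff
    using comm[OF pos_semidefD(1)[OF P]] comm[OF pos_semidefD(1)[OF Q]]
      comm[OF pos_defD(1)[OF pos_def_input_weight[OF R P, of B]]] by metis
  moreover have "quad (riccati_map A B Q R P) x \<ge> 0" for x
    unfolding quad_riccati_map_eq[OF R P]
    using pos_semidefD(2)[OF Q] pos_defD(3)[OF R] pos_semidefD(2)[OF P]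
    by (simp add: add_nonneg_nonneg)
  ultimately show ?thesis
    by (simp add: pos_semidef_def quad_def)
qed

text \<open>The input that is optimal for \<open>P'\<close> is merely admissible for
  \<open>P\<close>.\<close>

lemma riccati_map_mono:
  assumes R: "pos_def R" and P: "pos_semidef P" "pos_semidef P'" and le: "\<And>x. quad P x \<le> quad P' x"
  shows "quad (riccati_map A B Q R P) x \<le> quad (riccati_map A B Q R P') x"
proof -
  let ?u = "- (gain A B R P' *v x)"
  have "quad (riccati_map A B Q R P) x \<le> quad Q x + quad R ?u + quad P (A *v x + B *v ?u)"
    by (rule quad_riccati_map_le[OF R P(1)])
  also have "\<dots> \<le> quad (riccati_map A B Q R P') x"
    unfolding quad_riccati_map_eq[OF R P(2)] using le by simp
  finally show ?thesis .
qed

text \<open>Subtracting the two normal equations shows that \<open>?S1 *v ?d = ?p - ?q\<close>.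
  Pairing with \<open>?d\<close> and bounding \<open>quad ?S1\<close> below by \<open>r\<close>
  gives the estimate after cancelling one factor \<open>norm ?d\<close>. It serves both the limit of
  value iteration and the dependence on the multiplier.\<close>

lemma gain_diff_bound:
  assumes R1: "pos_def R1" and R2: "pos_def R2" and P1: "pos_semidef P1" and P2: "pos_semidef P2"
    and r: "\<And>u. r * (u \<bullet> u) \<le> quad R1 u"
  shows "r * norm (gain A B R1 P1 *v x - gain A B R2 P2 *v x) \<le>
    norm (transpose B *v ((P1 - P2) *v (A *v x)))
    + norm (((R1 + transpose B ** P1 ** B) - (R2 + transpose B ** P2 ** B)) *v (gain A B R2 P2 *v x))"
    (is "r * norm ?d \<le> norm ?p + norm ?q")
proof -
  let ?S1 = "R1 + transpose B ** P1 ** B"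
  have "?S1 *v ?d = ?p - ?q"
    using gain_equation[OF R1 P1, of B A x] gain_equation[OF R2 P2, of B A x]
    by (simp only: matrix_vector_mult_diff_distrib matrix_vector_mult_diff_rdistrib) simp
  then have le: "norm (?S1 *v ?d) \<le> norm ?p + norm ?q"
    by (metis norm_triangle_ineq4)
  have "r * (norm ?d * norm ?d) = r * (?d \<bullet> ?d)"
    by (simp add: dot_square_norm power2_eq_square)
  also have "\<dots> \<le> quad R1 ?d"
    by (rule r)
  also have "\<dots> \<le> quad ?S1 ?d"
    using pos_semidefD(2)[OF P1] by (simp add: quad_add quad_congruence)
  also have "\<dots> \<le> norm ?d * norm (?S1 *v ?d)"
    unfolding quad_def by (rule norm_cauchy_schwarz)
  also have "\<dots> \<le> norm ?d * (norm ?p + norm ?q)"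
    using le by (intro mult_left_mono) auto
  finally have "norm ?d * (r * norm ?d) \<le> norm ?d * (norm ?p + norm ?q)"
    by (simp add: algebra_simps)
  then show ?thesis
    by (cases "?d = 0") (auto simp: mult_le_cancel_left_pos)
qed

section \<open>Closed-loop costs\<close>

definition cost :: "real^'n^'n \<Rightarrow> real^'m^'n \<Rightarrow> real^'n^'n \<Rightarrow> real^'m^'m \<Rightarrow> real^'n^'m \<Rightarrow> real^'n \<Rightarrow> real"
  where "cost A B Q R K x = (\<Sum>t. quad Q (fb_state A B K x t) + quad R (fb_input A B K x t))"

lemma lqr_cost_eq_integral_cost: "lqr_cost M x0 A B Q R K = (\<integral>\<omega>. cost A B Q R K (x0 \<omega>) \<partial>M)"
  by (simp add: lqr_cost_def cost_def quad_def)

lemma fb_state_eq_funpow: "fb_state A B K x t = ((*v) (A - B ** K) ^^ t) x"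
  by (induction t) (auto simp: algebra_simps vec.neg matrix_vector_mul_assoc[symmetric])

lemma fb_state_linear: "linear (\<lambda>x. fb_state A B K x t)"
proof (induction t)
  case (Suc t)
  have "linear (\<lambda>y. A *v y + B *v (- (K *v y)))"
    by (auto intro!: linearI simp: algebra_simps vec.neg vec.add)
  from linear_compose[OF Suc this] show ?case
    by (simp add: o_def)
qed (simp add: linear_id[unfolded id_def])

lemma summable_fb_state_sq:
  assumes "K \<in> stabilizing A B"
  shows "summable (\<lambda>t. fb_state A B K x t \<bullet> fb_state A B K x t)"
proof -
  have s: "summable (\<lambda>t. norm (fb_state A B K x t))"
    using assms summable_norm_orbit unfolding stabilizing_def fb_state_eq_funpow by blast
  \<comment> \<open>Summable norms tend to 0, so eventually they are below 1 and dominate their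
    squares.\<close>
  then have "eventually (\<lambda>t. norm (fb_state A B K x t) < 1) sequentially"
    using order_tendstoD(2)[OF summable_LIMSEQ_zero[OF s]] by simp
  then have "eventually (\<lambda>t. norm (fb_state A B K x t \<bullet> fb_state A B K x t) \<le> norm (fb_state A B K x t)) sequentially"
    by eventually_elim (simp add: dot_square_norm power2_eq_square mult_left_le)
  then show ?thesis
    using s by (rule summable_comparison_test_ev)
qed

lemma summable_quad_fb_state:
  assumes "K \<in> stabilizing A B"
  shows "summable (\<lambda>t. quad W (fb_state A B K x t))"
proof -
  obtain c where c: "\<And>x. \<bar>quad W x\<bar> \<le> c * (x \<bullet> x)"
    using quad_upper_bound[of W] by blast
  show ?thesis
    by (rule summable_comparison_test'[OF summable_mult[OF summable_fb_state_sq[OF assms], of c]])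
      (use c in auto)
qed

lemma summable_quad_fb_input:
  assumes "K \<in> stabilizing A B"
  shows "summable (\<lambda>t. quad W (fb_input A B K x t))"
  using summable_quad_fb_state[OF assms, of "transpose K ** W ** K"]
  by (simp add: fb_input_def quad_congruence)

lemmas summable_stage_cost = summable_add[OF summable_quad_fb_state summable_quad_fb_input]

lemma cost_mono:
  assumes "K \<in> stabilizing A B" "\<And>x. quad Q x \<le> quad Q' x" "\<And>u. quad R u \<le> quad R' u"
  shows "cost A B Q R K x \<le> cost A B Q' R' K x"
  unfolding cost_def using assms by (intro suminf_le summable_stage_cost add_mono)

lemma cost_scaleR:
  assumes "K \<in> stabilizing A B"
  shows "cost A B (c *\<^sub>R Q) (c *\<^sub>R R) K x = c * cost A B Q R K x"
  unfolding cost_def quad_scaleR distrib_left[symmetric]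
  using assms by (intro suminf_mult summable_stage_cost)

lemma cost_add:
  assumes "K \<in> stabilizing A B"
  shows "cost A B (Q + Q') (R + R') K x = cost A B Q R K x + cost A B Q' R' K x"
  unfolding cost_def quad_add
  by (subst suminf_add[OF summable_stage_cost[OF assms assms] summable_stage_cost[OF assms assms]])
    (simp add: algebra_simps)

lemma cost_weighted:
  assumes K: "K \<in> stabilizing A B"
  shows "cost A B (weighted Q0 Q l) (weighted R0 R l) K x
    = cost A B Q0 R0 K x + (\<Sum>i\<in>UNIV. l $ i * cost A B (Q i) (R i) K x)"
proof -
  have "cost A B (\<Sum>i\<in>I. (l $ i) *\<^sub>R Q i) (\<Sum>i\<in>I. (l $ i) *\<^sub>R R i) K x
      = (\<Sum>i\<in>I. l $ i * cost A B (Q i) (R i) K x)" if "finite I" for I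
    using that
  proof (induction I rule: finite_induct)
    case empty
    show ?case by (simp add: cost_def)
  next
    case (insert i I)
    then show ?case
      by (simp add: cost_add[OF K] cost_scaleR[OF K])
  qed
  then show ?thesis
    by (simp add: weighted_def cost_add[OF K])
qed

text \<open>At a fixed point the completed square along the closed loop reads: stage cost minus the
  decrease of \<open>quad P\<close> equals the square. The decreases telescope to
  \<open>quad P x\<close>, since a stabilizing gain drives the state to 0.\<close>

lemma cost_complete_square:
  assumes R: "pos_def R" and P: "pos_semidef P" and fixpoint: "riccati_map A B Q R P = P"
    and K: "K \<in> stabilizing A B"
  shows "(\<lambda>t. quad (R + transpose B ** P ** B)
             (gain A B R P *v fb_state A B K x t - K *v fb_state A B K x t))
    sums (cost A B Q R K x - quad P x)"
proof -
  let ?x = "fb_state A B K x" and ?u = "fb_input A B K x"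
  have "(\<lambda>t. quad Q (?x t) + quad R (?u t)) sums cost A B Q R K x"
    unfolding cost_def by (intro summable_sums summable_stage_cost K)
  moreover have "(\<lambda>t. quad P (?x t) - quad P (?x (Suc t))) sums (quad P (?x 0) - 0)"
    by (intro telescope_sums' summable_LIMSEQ_zero summable_quad_fb_state K)
  ultimately have "(\<lambda>t. quad Q (?x t) + quad R (?u t) - (quad P (?x t) - quad P (?x (Suc t))))
      sums (cost A B Q R K x - (quad P (?x 0) - 0))"
    by (rule sums_diff)
  moreover have "quad Q (?x t) + quad R (?u t) - (quad P (?x t) - quad P (?x (Suc t)))
      = quad (R + transpose B ** P ** B) (gain A B R P *v ?x t - K *v ?x t)" for t
    using riccati_map_complete_square[OF R P, of Q "?x t" "?u t" A B]
    by (simp add: fixpoint fb_input_def add.commute)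
  ultimately show ?thesis
    by simp
qed

lemma riccati_le_cost:
  assumes "pos_def R" "pos_semidef P" "riccati_map A B Q R P = P" "K \<in> stabilizing A B"
  shows "quad P x \<le> cost A B Q R K x"
  using sums_le[OF _ sums_zero cost_complete_square[OF assms]]
    pos_defD(3)[OF pos_def_input_weight[OF assms(1,2)]] by auto

lemma riccati_gain_cost:
  assumes "pos_def R" "pos_semidef P" "riccati_map A B Q R P = P"
    "gain A B R P \<in> stabilizing A B"
  shows "cost A B Q R (gain A B R P) x = quad P x"
  using sums_unique[OF cost_complete_square[OF assms]] by simp

section \<open>The algebraic Riccati equation\<close>

text \<open>\<open>quad P\<close> is a Lyapunov function: it drops by at least
  \<open>quad Q x\<close> in each closed-loop step. As it stays nonnegative, it must also have been
  positive before the step.\<close>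

lemma riccati_fixpoint_stabilizing:
  assumes Q: "pos_def Q" and R: "pos_def R" and P: "pos_semidef P"
    and fixpoint: "riccati_map A B Q R P = P"
  shows "pos_def P" "gain A B R P \<in> stabilizing A B"
proof -
  let ?K = "gain A B R P"
  have eq: "quad P x = quad Q x + quad R (?K *v x) + quad P ((A - B ** ?K) *v x)" for x
    using quad_riccati_map_eq[OF R P, of A B Q x]
    by (simp add: fixpoint matrix_vector_mult_diff_rdistrib vec.neg matrix_vector_mul_assoc[symmetric])
  have gt: "quad P ((A - B ** ?K) *v x) < quad P x" if "x \<noteq> 0" for x
    using eq[of x] pos_defD(2)[OF Q that] pos_defD(3)[OF R, of "?K *v x"] by linarith
  have "quad P x > 0" if "x \<noteq> 0" for x
    using gt[OF that] pos_semidefD(2)[OF P, of "(A - B ** ?K) *v x"] by linarith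
  then show pd: "pos_def P"
    using pos_semidefD(1)[OF P] by (simp add: pos_def_def quad_def)
  show "?K \<in> stabilizing A B"
    unfolding stabilizing_def using lyapunov_spectral_radius[OF pd gt] by simp
qed

lemma pos_def_imp_pos_semidef: "pos_def P \<Longrightarrow> pos_semidef P"
  using pos_defD by (auto simp: pos_semidef_def quad_def)

text \<open>Each fixed point is the least cost over stabilizing gains and is attained by its own
  gain, so any two bound each other.\<close>

lemma riccati_fixpoint_unique:
  assumes Q: "pos_def Q" and R: "pos_def R"
    and P: "pos_semidef P" "riccati_map A B Q R P = P"
    and P': "pos_semidef P'" "riccati_map A B Q R P' = P'"
  shows "P = P'"
proof -
  have le: "quad X x \<le> quad Y x"
    if X: "pos_semidef X" "riccati_map A B Q R X = X" and Y: "pos_semidef Y" "riccati_map A B Q R Y = Y" for X Y x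
    using riccati_le_cost[OF R X riccati_fixpoint_stabilizing(2)[OF Q R Y]]
      riccati_gain_cost[OF R Y riccati_fixpoint_stabilizing(2)[OF Q R Y]] by metis
  have "quad P x = quad P' x" for x
    using le[OF P P'] le[OF P' P] by (simp add: order_antisym)
  \<comment> \<open>With the constant 0, \<open>norm_symmetric_matrix_le\<close> turns equality of
    quadratic forms into equality of symmetric matrices.\<close>
  then have "\<bar>quad (P - P') x\<bar> \<le> 0 * (x \<bullet> x)" for x
    by (simp add: quad_diff)
  moreover have "transpose (P - P') = P - P'"
    using pos_semidefD(1)[OF P(1)] pos_semidefD(1)[OF P'(1)]
    by (simp add: transpose_def vec_eq_iff)
  ultimately have "norm ((P - P') *v x) \<le> 0 * norm x" for x
    using norm_symmetric_matrix_le by blast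
  then show ?thesis
    by (simp add: matrix_eq matrix_vector_mult_diff_rdistrib)
qed

section \<open>Existence of a Riccati solution by value iteration\<close>

lemma tendsto_matrix_vector_mult:
  fixes f :: "'b \<Rightarrow> real^'n^'m"
  assumes "(f \<longlongrightarrow> M) F" "(g \<longlongrightarrow> y) F"
  shows "((\<lambda>t. f t *v g t) \<longlongrightarrow> M *v y) F"
  unfolding matrix_vector_mult_def
  using assms by (intro vec_tendstoI) (simp, intro tendsto_intros)

text \<open>Polarization at the basis vectors expresses every entry through three values of the
  quadratic form.\<close>

lemma symmetric_convergent_if_quad_convergent:
  fixes P :: "nat \<Rightarrow> real^'n^'n"
  assumes sym: "\<And>t. transpose (P t) = P t" and conv: "\<And>x. convergent (\<lambda>t. quad (P t) x)"
  shows "convergent P"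
proof -
  have "convergent (\<lambda>t. P t $ i $ j)" for i j
  proof -
    have "P t $ i $ j = 1 / 2 * (quad (P t) (axis i 1 + axis j 1) - quad (P t) (axis i 1) - quad (P t) (axis j 1))" for t
      by (simp add: quad_plus[OF sym] matrix_vector_mult_basis inner_axis' column_def)
    then show ?thesis
      by (simp only:) (intro convergent_mult convergent_diff conv convergent_const)
  qed
  then obtain L where L: "\<And>i j. (\<lambda>t. P t $ i $ j) \<longlonglongrightarrow> L i j"
    unfolding convergent_def by metis
  have "P \<longlonglongrightarrow> (\<chi> i j. L i j)"
    using L by (intro vec_tendstoI) simp
  then show ?thesis
    unfolding convergent_def by blast
qed

text \<open>Value iteration from \<open>0\<close>: the iterates increase, and the cost of any control
  steering the state to \<open>0\<close> bounds them.\<close>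

lemma riccati_fixpoint_exists:
  assumes ctrl: "controllable A B" and Q: "pos_def Q" and R: "pos_def R"
  shows "\<exists>P. pos_semidef P \<and> riccati_map A B Q R P = P"
proof -
  define P where "P t = (riccati_map A B Q R ^^ t) 0" for t
  have P_Suc: "P (Suc t) = riccati_map A B Q R (P t)" and P_0: "P 0 = 0" for t
    by (simp_all add: P_def)
  have psd: "pos_semidef (P t)" for t
  proof (induction t)
    case 0
    have "transpose 0 = (0 :: real^'n^'n)"
      by (simp add: transpose_def vec_eq_iff)
    then show ?case by (simp add: P_0 pos_semidef_def)
  next
    case (Suc t)
    then show ?case
      unfolding P_Suc by (rule pos_semidef_riccati_map[OF pos_def_imp_pos_semidef[OF Q] R])
  qed
  have step: "quad (P t) x \<le> quad (P (Suc t)) x" for t x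
  proof (induction t arbitrary: x)
    case 0
    show ?case using pos_semidefD(2)[OF psd] by (simp add: P_0)
  next
    case (Suc t)
    then show ?case
      using riccati_map_mono[OF R psd psd, of t "Suc t"] by (simp add: P_Suc)
  qed
  have inc: "incseq (\<lambda>t. quad (P t) x)" for x
    by (rule incseq_SucI) (rule step)
  \<comment> \<open>Each application of the map is bounded by one stage of the arbitrary input
    \<open>u\<close>. The induction keeps \<open>t\<close> free, because splitting off the last
    stage leaves the iterate \<open>P (Suc t)\<close>.\<close>
  have le_traj: "quad (P (t + r)) x \<le>
      (\<Sum>s<r. quad Q (traj A B u x s) + quad R (u s)) + quad (P t) (traj A B u x r)" for t r u x
  proof (induction r arbitrary: t)
    case (Suc r)
    have "quad (P (t + Suc r)) x \<le>
      (\<Sum>s<r. quad Q (traj A B u x s) + quad R (u s)) + quad (P (Suc t)) (traj A B u x r)"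
      using Suc[of "Suc t"] by simp
    also have "quad (P (Suc t)) (traj A B u x r) \<le>
        quad Q (traj A B u x r) + quad R (u r) + quad (P t) (traj A B u x (Suc r))"
      unfolding P_Suc traj.simps by (rule quad_riccati_map_le[OF R psd])
    finally show ?case by simp
  qed simp
  have "convergent (\<lambda>t. quad (P t) x)" for x
  proof -
    obtain u T where u: "traj A B u x T = 0"
      using ctrl unfolding controllable_def by blast
    \<comment> \<open>The terminal term vanishes because \<open>u\<close> reaches 0 at time
      \<open>T\<close>, and \<open>P t\<close> lies below \<open>P (t + T)\<close>.\<close>
    have "quad (P t) x \<le> (\<Sum>s<T. quad Q (traj A B u x s) + quad R (u s))" for t
      using le_traj[of t T x u] incseqD[OF inc, of t "t + T" x] by (simp add: u)
    then show ?thesis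
      using incseq_convergent[OF inc] unfolding convergent_def by metis
  qed
  then obtain L where L: "P \<longlonglongrightarrow> L"
    using symmetric_convergent_if_quad_convergent[of P] pos_semidefD(1)[OF psd]
    unfolding convergent_def by blast
  have lim: "(\<lambda>t. P t *v y) \<longlonglongrightarrow> L *v y" for y
    by (intro tendsto_matrix_vector_mult L tendsto_const)
  have symL: "transpose L = L"
    unfolding symmetric_matrix_iff
  proof (intro allI)
    fix x y
    have "x \<bullet> (P t *v y) = y \<bullet> (P t *v x)" for t
      using pos_semidefD(1)[OF psd] unfolding symmetric_matrix_iff by blast
    moreover have "(\<lambda>t. x \<bullet> (P t *v y)) \<longlonglongrightarrow> x \<bullet> (L *v y)" "(\<lambda>t. y \<bullet> (P t *v x)) \<longlonglongrightarrow> y \<bullet> (L *v x)"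
      by (intro tendsto_intros lim)+
    ultimately show "x \<bullet> (L *v y) = y \<bullet> (L *v x)"
      by (simp add: LIMSEQ_unique)
  qed
  have "(\<lambda>t. quad (P t) x) \<longlonglongrightarrow> quad L x" for x
    unfolding quad_def by (intro tendsto_intros lim)
  then have "quad L x \<ge> 0" for x
    using pos_semidefD(2)[OF psd] by (meson LIMSEQ_le_const)
  then have psdL: "pos_semidef L"
    using symL by (simp add: pos_semidef_def quad_def)
  obtain r where r: "r > 0" "\<And>u. r * (u \<bullet> u) \<le> quad R u"
    using quad_lower_bound[OF R] by blast
  have limK: "(\<lambda>t. gain A B R (P t) *v x) \<longlonglongrightarrow> gain A B R L *v x" for x
  proof -
    let ?S = "\<lambda>t. (R + transpose B ** P t ** B) - (R + transpose B ** L ** B)"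
    let ?y = "gain A B R L *v x"
    define E where "E t = norm (transpose B *v ((P t - L) *v (A *v x))) + norm (?S t *v ?y)" for t
    \<comment> \<open>\<open>R\<close> cancels, so both terms of \<open>E t\<close> contain the
      factor \<open>P t - L\<close> and tend to 0.\<close>
    have S: "?S t *v ?y = transpose B *v ((P t - L) *v (B *v ?y))" for t
      by (simp add: algebra_simps matrix_vector_mul_assoc[symmetric] vec.diff)
    have "(\<lambda>t. transpose B *v ((P t - L) *v z)) \<longlonglongrightarrow> transpose B *v ((L - L) *v z)" for z
      by (intro tendsto_matrix_vector_mult tendsto_diff L tendsto_const)
    then have "(\<lambda>t. transpose B *v ((P t - L) *v z)) \<longlonglongrightarrow> 0" for z
      by simp
    then have "E \<longlonglongrightarrow> 0 + 0"
      unfolding E_def S by (intro tendsto_add tendsto_norm_zero)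
    then have "(\<lambda>t. E t / r) \<longlonglongrightarrow> 0"
      by (rule tendsto_eq_rhs[OF tendsto_divide[OF _ tendsto_const]]) (use r(1) in auto)
    moreover have "norm (gain A B R (P t) *v x - ?y) \<le> E t / r" for t
    proof -
      have "r * norm (gain A B R (P t) *v x - ?y) \<le> E t"
        unfolding E_def by (rule gain_diff_bound[OF R R psd psdL r(2)])
      then show ?thesis
        using r(1) by (simp only: pos_le_divide_eq mult.commute)
    qed
    ultimately have "(\<lambda>t. gain A B R (P t) *v x - ?y) \<longlonglongrightarrow> 0"
      by (rule Lim_null_comparison[OF always_eventually[OF allI], rotated])
    then show ?thesis
      by (simp add: LIM_zero_iff)
  qed
  have "riccati_map A B Q R L *v x = L *v x" for x
  proof (rule LIMSEQ_unique)
    show "(\<lambda>t. P (Suc t) *v x) \<longlonglongrightarrow> riccati_map A B Q R L *v x"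
      unfolding P_Suc riccati_map_apply
      by (intro tendsto_intros tendsto_matrix_vector_mult lim limK L)
    show "(\<lambda>t. P (Suc t) *v x) \<longlonglongrightarrow> L *v x"
      using lim by (rule LIMSEQ_Suc)
  qed
  then show ?thesis
    using psdL by (auto simp: matrix_eq)
qed

text \<open>Existence and uniqueness of the fixed point give the definite description in
  \<open>riccati_solution\<close> its meaning.\<close>

lemma riccati_solution_properties:
  assumes "controllable A B" and Q: "pos_def Q" and R: "pos_def R"
  shows "pos_def (riccati_solution A B Q R)"
    "riccati_map A B Q R (riccati_solution A B Q R) = riccati_solution A B Q R"
    "gain A B R (riccati_solution A B Q R) \<in> stabilizing A B"
proof -
  obtain P where P: "pos_semidef P" "riccati_map A B Q R P = P"
    using riccati_fixpoint_exists[OF assms] by blast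
  note stab = riccati_fixpoint_stabilizing[OF Q R P]
  have "riccati_solution A B Q R = P"
    unfolding riccati_solution_def riccati_map_def[symmetric]
  proof (rule the_equality)
    show "pos_def P \<and> P = riccati_map A B Q R P"
      using P stab by simp
    show "P' = P" if "pos_def P' \<and> P' = riccati_map A B Q R P'" for P'
      using riccati_fixpoint_unique[OF Q R _ _ P, of P'] that pos_def_imp_pos_semidef[of P'] by simp
  qed
  then show "pos_def (riccati_solution A B Q R)"
    "riccati_map A B Q R (riccati_solution A B Q R) = riccati_solution A B Q R"
    "gain A B R (riccati_solution A B Q R) \<in> stabilizing A B"
    using P stab by simp_all
qed

section \<open>Expected costs\<close>

text \<open>The cost is a quadratic form in the initial state, and an identity second moment turns
  the expectation of such a form into its trace. From here on only deterministic costs from basis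
  vectors occur.\<close>

lemma lqr_cost_eq_sum:
  fixes x0 :: "'w \<Rightarrow> real^'n"
  assumes K: "K \<in> stabilizing A B"
    and cov: "has_bochner_integral M (\<lambda>\<omega>. \<chi> i j. x0 \<omega> $ i * x0 \<omega> $ j) (mat 1 :: real^'n^'n)"
  shows "lqr_cost M x0 A B Q R K = (\<Sum>i\<in>UNIV. cost A B Q R K (axis i 1))"
proof -
  define W where "W = Q + transpose K ** R ** K"
  let ?e = "\<lambda>i. fb_state A B K (axis i 1)"
  \<comment> \<open>The matrix of that form: mixed costs of the orbits of two basis vectors.\<close>
  define a where "a i j = (\<Sum>t. ?e i t \<bullet> (W *v ?e j t))" for i j
  have stage: "quad Q (fb_state A B K x t) + quad R (fb_input A B K x t) = quad W (fb_state A B K x t)" for x t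
    by (simp add: W_def quad_add quad_congruence fb_input_def)
  have summ: "summable (\<lambda>t. ?e i t \<bullet> (W *v ?e j t))" for i j
  proof (rule summable_comparison_test')
    let ?c = "onorm ((*v) W)"
    show "summable (\<lambda>t. ?c * (?e i t \<bullet> ?e i t + ?e j t \<bullet> ?e j t))"
      by (intro summable_mult summable_add summable_fb_state_sq K)
    fix t
    have "\<bar>?e i t \<bullet> (W *v ?e j t)\<bar> \<le> norm (?e i t) * norm (W *v ?e j t)"
      by (rule Cauchy_Schwarz_ineq2)
    also have "\<dots> \<le> norm (?e i t) * (?c * norm (?e j t))"
      by (intro mult_left_mono onorm) auto
    also have "\<dots> = ?c * (norm (?e i t) * norm (?e j t))"
      by simp
    also have "\<dots> \<le> ?c * ((norm (?e i t))\<^sup>2 + (norm (?e j t))\<^sup>2)"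
    proof (intro mult_left_mono)
      have "2 * (norm (?e i t) * norm (?e j t)) \<le> (norm (?e i t))\<^sup>2 + (norm (?e j t))\<^sup>2"
        using sum_squares_bound[of "norm (?e i t)" "norm (?e j t)"] by simp
      moreover have "0 \<le> norm (?e i t) * norm (?e j t)"
        by simp
      ultimately show "norm (?e i t) * norm (?e j t) \<le> (norm (?e i t))\<^sup>2 + (norm (?e j t))\<^sup>2"
        by linarith
      show "0 \<le> ?c"
        by (intro onorm_pos_le) auto
    qed
    finally show "norm (?e i t \<bullet> (W *v ?e j t)) \<le> ?c * (?e i t \<bullet> ?e i t + ?e j t \<bullet> ?e j t)"
      by (simp add: dot_square_norm)
  qed
  have cost_eq: "cost A B Q R K x = (\<Sum>i\<in>UNIV. \<Sum>j\<in>UNIV. x $ i * x $ j * a i j)" for x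
  proof -
    have x: "fb_state A B K x t = (\<Sum>i\<in>UNIV. (x $ i) *\<^sub>R ?e i t)" for t
    proof -
      have "fb_state A B K x t = fb_state A B K (\<Sum>i\<in>UNIV. (x $ i) *\<^sub>R axis i 1) t"
        using basis_expansion[of x] by (simp add: scalar_mult_eq_scaleR)
      then show ?thesis
        by (simp add: linear_sum[OF fb_state_linear] linear_scale[OF fb_state_linear])
    qed
    have "quad W (fb_state A B K x t)
        = (\<Sum>i\<in>UNIV. \<Sum>j\<in>UNIV. x $ i * x $ j * (?e i t \<bullet> (W *v ?e j t)))" for t
      unfolding quad_def x
      by (simp add: inner_sum_left inner_sum_right linear_sum[OF matrix_vector_mul_linear]
          matrix_vector_mult_scaleR sum_distrib_left mult.assoc)
        (subst sum.swap, simp add: mult.left_commute)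
    then show ?thesis
      unfolding cost_def stage a_def
      by (simp add: suminf_sum summable_sum summable_mult summ suminf_mult)
  qed
  have "has_bochner_integral M (\<lambda>\<omega>. x0 \<omega> $ i * x0 \<omega> $ j) (if i = j then 1 else 0)" for i j
  proof -
    have "bounded_linear (\<lambda>X :: real^'n^'n. X $ i $ j)"
      by (intro bounded_linear_compose[OF bounded_linear_vec_nth bounded_linear_vec_nth])
    from has_bochner_integral_bounded_linear[OF this cov] show ?thesis
      by (simp add: mat_def)
  qed
  then have "has_bochner_integral M (\<lambda>\<omega>. \<Sum>i\<in>UNIV. \<Sum>j\<in>UNIV. x0 \<omega> $ i * x0 \<omega> $ j * a i j)
      (\<Sum>i\<in>UNIV. \<Sum>j\<in>UNIV. (if i = j then 1 else 0) * a i j)"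
    by (intro has_bochner_integral_sum has_bochner_integral_mult_left)
  then have "lqr_cost M x0 A B Q R K = (\<Sum>i\<in>UNIV. a i i)"
    unfolding lqr_cost_eq_integral_cost cost_eq
    by (simp add: has_bochner_integral_integral_eq if_distrib[of "\<lambda>x. x * _"] cong: if_cong)
  moreover have "a i i = cost A B Q R K (axis i 1)" for i
    unfolding a_def cost_def stage by (simp only: quad_def)
  ultimately show ?thesis by simp
qed

section \<open>Dependence on the multipliers\<close>

lemma quad_weighted: "quad (weighted W0 W l) x = quad W0 x + (\<Sum>i\<in>UNIV. l $ i * quad (W i) x)"
  by (simp add: weighted_def quad_add quad_sum quad_scaleR)

lemma quad_weighted_ge:
  assumes "\<And>i. pos_semidef (W i)" "l \<in> nonneg_orthant"
  shows "quad W0 x \<le> quad (weighted W0 W l) x"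
  using assms
  by (auto simp: quad_weighted nonneg_orthant_def intro!: sum_nonneg mult_nonneg_nonneg pos_semidefD(2))

lemma pos_def_weighted:
  assumes W0: "pos_def W0" and W: "\<And>i. pos_semidef (W i)" and l: "l \<in> nonneg_orthant"
  shows "pos_def (weighted W0 W l)"
proof -
  have "transpose (weighted W0 W l) = weighted W0 W l"
    using pos_defD(1)[OF W0] pos_semidefD(1)[OF W]
    by (simp add: weighted_def transpose_def vec_eq_iff)
  moreover have "quad (weighted W0 W l) x > 0" if "x \<noteq> 0" for x
    using pos_defD(2)[OF W0 that] quad_weighted_ge[where W = W, OF W l, of W0 x] by linarith
  ultimately show ?thesis
    by (simp add: pos_def_def quad_def)
qed

text \<open>Each \<open>W i\<close> is dominated by a multiple \<open>\<theta> i\<close> of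
  \<open>W0\<close>, which lies below every weighted matrix on the orthant. The relative form of the
  bound is what passes through sums of stage costs, and \<kappa> is uniform in
  \<open>l\<close>.\<close>

lemma weighted_relative_bound:
  fixes W :: "'k::finite \<Rightarrow> real^'a^'a"
  assumes W0: "pos_def W0" and W: "\<And>i. pos_semidef (W i)"
  shows "\<exists>\<kappa>\<ge>0. \<forall>l\<in>nonneg_orthant. \<forall>l'. \<forall>x.
    quad (weighted W0 W l') x \<le> (1 + \<kappa> * norm (l' - l)) * quad (weighted W0 W l) x"
proof -
  have "\<forall>i. \<exists>\<theta>\<ge>0. \<forall>x. quad (W i) x \<le> \<theta> * quad W0 x"
    using quad_dominated[OF W0] by blast
  then obtain \<theta> where \<theta>: "\<And>i. \<theta> i \<ge> 0" "\<And>i x. quad (W i) x \<le> \<theta> i * quad W0 x"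
    by metis
  have "quad (weighted W0 W l') x \<le> (1 + sum \<theta> UNIV * norm (l' - l)) * quad (weighted W0 W l) x"
    if l: "l \<in> nonneg_orthant" for l l' x
  proof -
    have "(l' $ i - l $ i) * quad (W i) x \<le> norm (l' - l) * (\<theta> i * quad W0 x)" for i
    proof -
      have "(l' $ i - l $ i) * quad (W i) x \<le> norm (l' - l) * quad (W i) x"
        using component_le_norm_cart[of "l' - l" i] pos_semidefD(2)[OF W]
        by (intro mult_right_mono) auto
      also have "\<dots> \<le> norm (l' - l) * (\<theta> i * quad W0 x)"
        using \<theta>(2) by (intro mult_left_mono) auto
      finally show ?thesis .
    qed
    then have "(\<Sum>i\<in>UNIV. (l' $ i - l $ i) * quad (W i) x) \<le> (\<Sum>i\<in>UNIV. norm (l' - l) * (\<theta> i * quad W0 x))"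
      by (rule sum_mono)
    also have "\<dots> = sum \<theta> UNIV * norm (l' - l) * quad W0 x"
      by (simp add: sum_distrib_left sum_distrib_right mult_ac)
    also have "\<dots> \<le> sum \<theta> UNIV * norm (l' - l) * quad (weighted W0 W l) x"
      using \<theta>(1) quad_weighted_ge[where W = W, OF W l] by (intro mult_left_mono) (auto simp: sum_nonneg)
    finally show ?thesis
      by (simp add: quad_weighted left_diff_distrib sum_subtractf algebra_simps)
  qed
  then show ?thesis
    using \<theta>(1) by (intro exI[of _ "sum \<theta> UNIV"]) (auto simp: sum_nonneg)
qed

text \<open>The two relative bounds give a difference of forms at most \<delta> times the larger
  one, which is at most (1 + \<kappa>) \<open>quad Y\<close>. Using \<kappa> in place of \<delta> in
  that factor keeps the estimate linear in \<delta>.\<close>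

lemma norm_diff_le_of_relative_bounds:
  assumes X: "pos_semidef X" and Y: "pos_semidef Y" and \<delta>: "0 \<le> \<delta>" "\<delta> \<le> \<kappa>"
    and XY: "\<And>x. quad X x \<le> (1 + \<delta>) * quad Y x" and YX: "\<And>x. quad Y x \<le> (1 + \<delta>) * quad X x"
    and c: "\<And>x. quad Y x \<le> c * (x \<bullet> x)"
  shows "norm ((X - Y) *v x) \<le> \<delta> * ((1 + \<kappa>) * c) * norm x"
proof (rule norm_symmetric_matrix_le)
  show "transpose (X - Y) = X - Y"
    using pos_semidefD(1)[OF X] pos_semidefD(1)[OF Y] by (simp add: transpose_def vec_eq_iff)
  fix x
  have pos: "0 \<le> quad Y x" "0 \<le> quad X x"
    using pos_semidefD(2)[OF X] pos_semidefD(2)[OF Y] by auto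
  have "quad Y x \<le> (1 + \<kappa>) * quad Y x"
    using \<delta> pos by (simp add: distrib_right)
  moreover have XY': "quad X x \<le> (1 + \<kappa>) * quad Y x"
    using XY[of x] mult_right_mono[of "1 + \<delta>" "1 + \<kappa>" "quad Y x"] \<delta> pos by linarith
  ultimately have "\<delta> * quad Y x \<le> \<delta> * ((1 + \<kappa>) * quad Y x)" "\<delta> * quad X x \<le> \<delta> * ((1 + \<kappa>) * quad Y x)"
    using \<delta> by (auto intro: mult_left_mono)
  then have "\<bar>quad (X - Y) x\<bar> \<le> \<delta> * ((1 + \<kappa>) * quad Y x)"
    using XY[of x] YX[of x] by (simp add: quad_diff distrib_right abs_le_iff)
  also have "\<dots> \<le> \<delta> * ((1 + \<kappa>) * (c * (x \<bullet> x)))"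
    using \<delta> c by (intro mult_left_mono) auto
  finally show "\<bar>quad (X - Y) x\<bar> \<le> \<delta> * ((1 + \<kappa>) * c) * (x \<bullet> x)"
    by (simp add: mult.assoc)
qed

section \<open>Perturbation of the Riccati solution and of the optimal gain\<close>

locale weighted_lqr =
  fixes A :: "real^'n^'n" and B :: "real^'m^'n"
    and Q0 :: "real^'n^'n" and R0 :: "real^'m^'m"
    and Q :: "'k::finite \<Rightarrow> real^'n^'n" and R :: "'k \<Rightarrow> real^'m^'m"
  assumes controllable: "controllable A B"
    and Q0: "pos_def Q0" and R0: "pos_def R0"
    and Q: "\<And>i. pos_semidef (Q i)" and R: "\<And>i. pos_semidef (R i)"
begin

abbreviation "Qw l \<equiv> weighted Q0 Q l"
abbreviation "Rw l \<equiv> weighted R0 R l"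
abbreviation "P l \<equiv> riccati_solution A B (Qw l) (Rw l)"
abbreviation "K l \<equiv> optimal_gain A B Q0 R0 Q R l"
abbreviation "S l \<equiv> Rw l + transpose B ** P l ** B"

lemma optimal_gain_eq_gain: "K l = gain A B (Rw l) (P l)"
  by (simp add: optimal_gain_def gain_def Let_def)

lemma
  assumes "l \<in> nonneg_orthant"
  shows pos_def_Qw: "pos_def (Qw l)" and pos_def_Rw: "pos_def (Rw l)"
  using pos_def_weighted assms Q0 R0 Q R by blast+

lemma
  assumes l: "l \<in> nonneg_orthant"
  shows pos_semidef_P: "pos_semidef (P l)"
    and riccati_P: "riccati_map A B (Qw l) (Rw l) (P l) = P l"
    and K_stabilizing: "K l \<in> stabilizing A B"
  using riccati_solution_properties[OF controllable pos_def_Qw[OF l] pos_def_Rw[OF l]]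
  by (auto simp: optimal_gain_eq_gain intro: pos_def_imp_pos_semidef)

lemma quad_P_le_cost:
  assumes "l \<in> nonneg_orthant" "G \<in> stabilizing A B"
  shows "quad (P l) x \<le> cost A B (Qw l) (Rw l) G x"
  using assms by (intro riccati_le_cost pos_def_Rw pos_semidef_P riccati_P)

lemma cost_K_eq_quad_P:
  assumes "l \<in> nonneg_orthant"
  shows "cost A B (Qw l) (Rw l) (K l) x = quad (P l) x"
  using K_stabilizing[OF assms] unfolding optimal_gain_eq_gain
  by (intro riccati_gain_cost pos_def_Rw pos_semidef_P riccati_P assms)

text \<open>\<open>K l\<close> is a competitor for the weights at \<open>l'\<close>; its cost there
  is at most the relative factor times its cost at \<open>l\<close>, which is
  \<open>quad (P l)\<close>. Taking \<open>q + r\<close> as \<kappa> serves both weights, and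
  \<open>S\<close> inherits the bound from \<open>Rw\<close> and \<open>P\<close>.\<close>

lemma relative_bounds:
  "\<exists>\<kappa>\<ge>0. \<forall>l\<in>nonneg_orthant. \<forall>l'\<in>nonneg_orthant.
    (\<forall>x. quad (P l') x \<le> (1 + \<kappa> * norm (l' - l)) * quad (P l) x) \<and>
    (\<forall>u. quad (S l') u \<le> (1 + \<kappa> * norm (l' - l)) * quad (S l) u)"
proof -
  obtain q where q: "q \<ge> 0" "\<And>l l' x. l \<in> nonneg_orthant \<Longrightarrow>
      quad (Qw l') x \<le> (1 + q * norm (l' - l)) * quad (Qw l) x"
    using weighted_relative_bound[of Q0 Q, OF Q0 Q] by blast
  obtain r where r: "r \<ge> 0" "\<And>l l' x. l \<in> nonneg_orthant \<Longrightarrow>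
      quad (Rw l') x \<le> (1 + r * norm (l' - l)) * quad (Rw l) x"
    using weighted_relative_bound[of R0 R, OF R0 R] by blast
  let ?\<kappa> = "q + r"
  let ?c = "\<lambda>l l'. 1 + ?\<kappa> * norm (l' - l)"
  have Qle: "quad (Qw l') x \<le> ?c l l' * quad (Qw l) x" if l: "l \<in> nonneg_orthant" for l l' x
  proof -
    have "(1 + q * norm (l' - l)) * quad (Qw l) x \<le> ?c l l' * quad (Qw l) x"
      using r(1) pos_defD(3)[OF pos_def_Qw[OF l]] by (intro mult_right_mono) (auto simp: distrib_right)
    then show ?thesis using q(2)[OF l, of l' x] by linarith
  qed
  have Rle: "quad (Rw l') x \<le> ?c l l' * quad (Rw l) x" if l: "l \<in> nonneg_orthant" for l l' x
  proof -
    have "(1 + r * norm (l' - l)) * quad (Rw l) x \<le> ?c l l' * quad (Rw l) x"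
      using q(1) pos_defD(3)[OF pos_def_Rw[OF l]] by (intro mult_right_mono) (auto simp: distrib_right)
    then show ?thesis using r(2)[OF l, of l' x] by linarith
  qed
  have Ple: "quad (P l') x \<le> ?c l l' * quad (P l) x"
    if l: "l \<in> nonneg_orthant" and l': "l' \<in> nonneg_orthant" for l l' x
  proof -
    have "quad (P l') x \<le> cost A B (Qw l') (Rw l') (K l) x"
      by (rule quad_P_le_cost[OF l' K_stabilizing[OF l]])
    also have "\<dots> \<le> cost A B (?c l l' *\<^sub>R Qw l) (?c l l' *\<^sub>R Rw l) (K l) x"
      unfolding quad_scaleR[symmetric]
      by (rule cost_mono[OF K_stabilizing[OF l]]) (simp_all only: quad_scaleR Qle[OF l] Rle[OF l])
    also have "\<dots> = ?c l l' * quad (P l) x"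
      by (simp only: cost_scaleR[OF K_stabilizing[OF l]] cost_K_eq_quad_P[OF l])
    finally show ?thesis .
  qed
  have Sle: "quad (S l') u \<le> ?c l l' * quad (S l) u"
    if l: "l \<in> nonneg_orthant" and l': "l' \<in> nonneg_orthant" for l l' u
    using Rle[OF l, of l' u] Ple[OF l l', of "B *v u"]
    by (simp add: quad_add quad_congruence distrib_left)
  show ?thesis
    using q(1) r(1) Ple Sle by (intro exI[of _ ?\<kappa>]) simp
qed

lemma optimal_gain_lipschitz:
  assumes l: "l \<in> nonneg_orthant"
  shows "\<exists>C\<ge>0. \<forall>l'\<in>nonneg_orthant. norm (l' - l) \<le> 1 \<longrightarrow>
    (\<forall>x. norm (K l' *v x - K l *v x) \<le> C * norm (l' - l) * norm x)"
proof -
  obtain \<kappa> where \<kappa>: "\<kappa> \<ge> 0"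
    and P_le: "\<And>l l' x. l \<in> nonneg_orthant \<Longrightarrow> l' \<in> nonneg_orthant \<Longrightarrow>
       quad (P l') x \<le> (1 + \<kappa> * norm (l' - l)) * quad (P l) x"
    and S_le: "\<And>l l' u. l \<in> nonneg_orthant \<Longrightarrow> l' \<in> nonneg_orthant \<Longrightarrow>
       quad (S l') u \<le> (1 + \<kappa> * norm (l' - l)) * quad (S l) u"
    using relative_bounds by (elim exE conjE) blast
  obtain p where p: "p \<ge> 0" "\<And>x. \<bar>quad (P l) x\<bar> \<le> p * (x \<bullet> x)"
    using quad_upper_bound[of "P l"] by blast
  obtain s where s: "s \<ge> 0" "\<And>x. \<bar>quad (S l) x\<bar> \<le> s * (x \<bullet> x)"
    using quad_upper_bound[of "S l"] by blast
  obtain r where r: "r > 0" "\<And>u. r * (u \<bullet> u) \<le> quad R0 u"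
    using quad_lower_bound[OF R0] by blast
  define a b k where "a = onorm ((*v) A)" and "b = onorm ((*v) (transpose B))" and "k = onorm ((*v) (K l))"
  have nonneg: "0 \<le> a" "0 \<le> b" "0 \<le> k"
    unfolding a_def b_def k_def by (intro onorm_pos_le matrix_vector_mul_bounded_linear)+
  have bounds: "norm (A *v x) \<le> a * norm x" "norm (transpose B *v x) \<le> b * norm x"
    "norm (K l *v x) \<le> k * norm x" for x
    unfolding a_def b_def k_def by (intro onorm matrix_vector_mul_bounded_linear)+
  \<comment> \<open>The two terms of \<open>gain_diff_bound\<close>: the first carries the change of
    \<open>P\<close> between \<open>transpose B\<close> and \<open>A\<close>, the second the change
    of \<open>S\<close> applied to \<open>K l\<close>.\<close>
  define C where "C = (b * (\<kappa> * ((1 + \<kappa>) * p)) * a + \<kappa> * ((1 + \<kappa>) * s) * k) / r"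
  have rC: "r * C = b * (\<kappa> * ((1 + \<kappa>) * p)) * a + \<kappa> * ((1 + \<kappa>) * s) * k"
    using r(1) by (simp add: C_def)
  have "norm (K l' *v x - K l *v x) \<le> C * norm (l' - l) * norm x"
    if l': "l' \<in> nonneg_orthant" and le1: "norm (l' - l) \<le> 1" for l' x
  proof -
    let ?d = "\<kappa> * norm (l' - l)"
    \<comment> \<open>Restricting to distance at most 1 keeps \<open>?d\<close> below \<kappa>, so
      the constants do not depend on \<open>l'\<close>.\<close>
    have d: "0 \<le> ?d" "?d \<le> \<kappa>"
      using \<kappa> le1 by (auto simp: mult_left_le)
    have dP: "norm ((P l' - P l) *v y) \<le> ?d * ((1 + \<kappa>) * p) * norm y" for y
    proof (rule norm_diff_le_of_relative_bounds[OF pos_semidef_P[OF l'] pos_semidef_P[OF l] d])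
      show "quad (P l') x \<le> (1 + ?d) * quad (P l) x" "quad (P l) x \<le> (1 + ?d) * quad (P l') x" for x
        using P_le[OF l l'] P_le[OF l' l] by (simp_all add: norm_minus_commute)
      show "quad (P l) x \<le> p * (x \<bullet> x)" for x
        using p(2)[of x] by linarith
    qed
    note S_psd = pos_def_imp_pos_semidef[OF pos_def_input_weight[OF pos_def_Rw pos_semidef_P]]
    have dS: "norm ((S l' - S l) *v y) \<le> ?d * ((1 + \<kappa>) * s) * norm y" for y
    proof (rule norm_diff_le_of_relative_bounds[OF S_psd[OF l' l'] S_psd[OF l l] d])
      show "quad (S l') x \<le> (1 + ?d) * quad (S l) x" "quad (S l) x \<le> (1 + ?d) * quad (S l') x" for x
        using S_le[OF l l'] S_le[OF l' l] by (simp_all add: norm_minus_commute)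
      show "quad (S l) x \<le> s * (x \<bullet> x)" for x
        using s(2)[of x] by linarith
    qed
    \<comment> \<open>\<open>R0\<close> lies below every \<open>Rw l'\<close>, so one coercivity
      constant works for all \<open>l'\<close>.\<close>
    have "r * (u \<bullet> u) \<le> quad (Rw l') u" for u
      using r(2)[of u] quad_weighted_ge[where W = R, OF R l', of R0 u] by linarith
    then have "r * norm (K l' *v x - K l *v x) \<le> norm (transpose B *v ((P l' - P l) *v (A *v x)))
        + norm ((S l' - S l) *v (K l *v x))"
      unfolding optimal_gain_eq_gain
      by (rule gain_diff_bound[OF pos_def_Rw[OF l'] pos_def_Rw[OF l] pos_semidef_P[OF l'] pos_semidef_P[OF l]])
    also have "norm (transpose B *v ((P l' - P l) *v (A *v x))) \<le> b * (?d * ((1 + \<kappa>) * p) * (a * norm x))"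
    proof -
      have "norm (transpose B *v ((P l' - P l) *v (A *v x))) \<le> b * norm ((P l' - P l) *v (A *v x))"
        by (rule bounds)
      also have "\<dots> \<le> b * (?d * ((1 + \<kappa>) * p) * norm (A *v x))"
        by (intro mult_left_mono dP nonneg)
      also have "\<dots> \<le> b * (?d * ((1 + \<kappa>) * p) * (a * norm x))"
        using \<kappa> p(1) nonneg by (intro mult_left_mono bounds mult_nonneg_nonneg) auto
      finally show ?thesis .
    qed
    also have "norm ((S l' - S l) *v (K l *v x)) \<le> ?d * ((1 + \<kappa>) * s) * (k * norm x)"
    proof -
      have "norm ((S l' - S l) *v (K l *v x)) \<le> ?d * ((1 + \<kappa>) * s) * norm (K l *v x)"
        by (rule dS)
      also have "\<dots> \<le> ?d * ((1 + \<kappa>) * s) * (k * norm x)"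
        using \<kappa> s(1) by (intro mult_left_mono bounds mult_nonneg_nonneg) auto
      finally show ?thesis .
    qed
    finally have "r * norm (K l' *v x - K l *v x) \<le> (r * C) * (norm (l' - l) * norm x)"
      unfolding rC by (simp add: algebra_simps)
    then show ?thesis
      using r(1) by simp
  qed
  moreover have "C \<ge> 0"
    unfolding C_def using nonneg \<kappa> p(1) s(1) r(1) by auto
  ultimately show ?thesis
    by blast
qed

text \<open>Completing the square at \<open>l'\<close> along the closed loop of \<open>K l\<close> expresses the gap as a sum of
  \<open>quad (S l') ((K l' - K l) *v x t)\<close>, hence it is quadratic in \<open>norm (l' - l)\<close>.\<close>

lemma cost_gap_quadratic:
  assumes l: "l \<in> nonneg_orthant"
  shows "\<exists>C\<ge>0. \<forall>l'\<in>nonneg_orthant. norm (l' - l) \<le> 1 \<longrightarrow>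
    cost A B (Qw l') (Rw l') (K l) x - quad (P l') x \<le> C * (norm (l' - l))\<^sup>2"
proof -
  obtain \<kappa> where \<kappa>: "\<kappa> \<ge> 0"
    and S_le: "\<And>l l' u. l \<in> nonneg_orthant \<Longrightarrow> l' \<in> nonneg_orthant \<Longrightarrow>
       quad (S l') u \<le> (1 + \<kappa> * norm (l' - l)) * quad (S l) u"
    using relative_bounds by (elim exE conjE) blast
  obtain s where s: "s \<ge> 0" "\<And>x. \<bar>quad (S l) x\<bar> \<le> s * (x \<bullet> x)"
    using quad_upper_bound[of "S l"] by blast
  obtain L where L: "L \<ge> 0" "\<And>l' x. l' \<in> nonneg_orthant \<Longrightarrow> norm (l' - l) \<le> 1 \<Longrightarrow>
       norm (K l' *v x - K l *v x) \<le> L * norm (l' - l) * norm x"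
    using optimal_gain_lipschitz[OF l] by blast
  let ?x = "fb_state A B (K l) x"
  define E where "E = (\<Sum>t. ?x t \<bullet> ?x t)"
  have E: "(\<lambda>t. ?x t \<bullet> ?x t) sums E"
    unfolding E_def by (intro summable_sums summable_fb_state_sq K_stabilizing l)
  \<comment> \<open>\<open>(1 + \<kappa>) * s\<close> bounds \<open>S l'\<close>,
    \<open>L\<^sup>2\<close> comes from the squared gain difference, and \<open>E\<close> is the
    total squared state under the fixed gain \<open>K l\<close>.\<close>
  define C where "C = (1 + \<kappa>) * s * L\<^sup>2 * E"
  have "E \<ge> 0"
    using sums_le[OF _ sums_zero E] by simp
  have "cost A B (Qw l') (Rw l') (K l) x - quad (P l') x \<le> C * (norm (l' - l))\<^sup>2"
    if l': "l' \<in> nonneg_orthant" and le1: "norm (l' - l) \<le> 1" for l'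
  proof -
    let ?h = "norm (l' - l)"
    have le: "quad (S l') (K l' *v y - K l *v y) \<le> (1 + \<kappa>) * s * L\<^sup>2 * ?h\<^sup>2 * (y \<bullet> y)" for y
    proof -
      let ?v = "K l' *v y - K l *v y"
      have "norm ?v * norm ?v \<le> (L * ?h * norm y) * (L * ?h * norm y)"
        using L(1) by (intro mult_mono L l' le1) auto
      then have v: "?v \<bullet> ?v \<le> L\<^sup>2 * ?h\<^sup>2 * (y \<bullet> y)"
        by (simp add: dot_square_norm power2_eq_square mult_ac)
      have "quad (S l) ?v \<ge> 0"
        by (intro pos_defD(3) pos_def_input_weight pos_def_Rw pos_semidef_P l)
      then have "(1 + \<kappa> * ?h) * quad (S l) ?v \<le> (1 + \<kappa>) * quad (S l) ?v"
        using \<kappa> le1 by (intro mult_right_mono) (auto simp: mult_left_le)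
      also have "\<dots> \<le> (1 + \<kappa>) * (s * (?v \<bullet> ?v))"
        using \<kappa> s(2)[of ?v] by (intro mult_left_mono) auto
      also have "\<dots> \<le> (1 + \<kappa>) * (s * (L\<^sup>2 * ?h\<^sup>2 * (y \<bullet> y)))"
        using \<kappa> s(1) v by (intro mult_left_mono) auto
      finally show ?thesis
        using S_le[OF l l', of ?v] by (simp add: mult.assoc)
    qed
    have gap: "(\<lambda>t. quad (S l') (K l' *v ?x t - K l *v ?x t)) sums
        (cost A B (Qw l') (Rw l') (K l) x - quad (P l') x)"
      unfolding optimal_gain_eq_gain[of l']
      by (intro cost_complete_square pos_def_Rw pos_semidef_P riccati_P K_stabilizing l l')
    have "(\<lambda>t. (1 + \<kappa>) * s * L\<^sup>2 * ?h\<^sup>2 * (?x t \<bullet> ?x t)) sums ((1 + \<kappa>) * s * L\<^sup>2 * ?h\<^sup>2 * E)"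
      by (intro sums_mult E)
    from sums_le[OF le gap this]
    have "cost A B (Qw l') (Rw l') (K l) x - quad (P l') x \<le> (1 + \<kappa>) * s * L\<^sup>2 * ?h\<^sup>2 * E" .
    then show ?thesis
      by (simp add: C_def mult_ac)
  qed
  moreover have "C \<ge> 0"
    unfolding C_def using \<kappa> s(1) \<open>E \<ge> 0\<close> by auto
  ultimately show ?thesis
    by blast
qed

section \<open>The Lagrangian and the dual function\<close>

context
  fixes M :: "'w measure" and x0 :: "'w \<Rightarrow> real^'n" and c :: "real^'k"
  assumes cov: "has_bochner_integral M (\<lambda>\<omega>. \<chi> i j. x0 \<omega> $ i * x0 \<omega> $ j) (mat 1 :: real^'n^'n)"
begin

abbreviation "Lag G l \<equiv> lagrangian M x0 A B Q0 R0 Q R c G l"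
abbreviation "D \<equiv> dual_function M x0 A B Q0 R0 Q R c"

text \<open>Costs are linear in the weights, so for fixed \<open>l\<close> the Lagrangian is the
  cost of a single regulator problem up to the constant \<open>l \<bullet> c\<close>.\<close>

lemma lagrangian_eq_sum_cost:
  assumes G: "G \<in> stabilizing A B"
  shows "Lag G l = (\<Sum>j\<in>UNIV. cost A B (Qw l) (Rw l) G (axis j 1)) - l \<bullet> c"
proof -
  have "(\<Sum>j\<in>UNIV. cost A B (Qw l) (Rw l) G (axis j 1)) = lqr_cost M x0 A B Q0 R0 G
      + (\<Sum>j\<in>UNIV. \<Sum>i\<in>UNIV. l $ i * cost A B (Q i) (R i) G (axis j 1))"
    by (simp add: cost_weighted[OF G] sum.distrib lqr_cost_eq_sum[OF G cov])
  also have "(\<Sum>j\<in>UNIV. \<Sum>i\<in>UNIV. l $ i * cost A B (Q i) (R i) G (axis j 1))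
      = (\<Sum>i\<in>UNIV. l $ i * lqr_cost M x0 A B (Q i) (R i) G)"
    by (subst sum.swap) (simp add: lqr_cost_eq_sum[OF G cov] sum_distrib_left)
  finally show ?thesis
    by (simp add: lagrangian_def inner_vec_def right_diff_distrib sum_subtractf)
qed

text \<open>\<open>K l\<close> minimizes the cost from every initial state at once, hence each
  summand of the Lagrangian; the minimum is attained, as \<open>LEAST\<close> requires.\<close>

lemma
  assumes l: "l \<in> nonneg_orthant"
  shows dual_function_eq_quad: "D l = (\<Sum>j\<in>UNIV. quad (P l) (axis j 1)) - l \<bullet> c"
    and dual_function_eq_lagrangian: "D l = Lag (K l) l"
proof -
  show eq: "D l = Lag (K l) l"
    unfolding dual_function_def
  proof (rule Least_equality)
    show "Lag (K l) l \<in> (\<lambda>G. Lag G l) ` stabilizing A B"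
      by (rule imageI[OF K_stabilizing[OF l]])
    fix d
    assume "d \<in> (\<lambda>G. Lag G l) ` stabilizing A B"
    then obtain G where G: "G \<in> stabilizing A B" "d = Lag G l"
      by blast
    then show "Lag (K l) l \<le> d"
      unfolding G(2) lagrangian_eq_sum_cost[OF G(1)] lagrangian_eq_sum_cost[OF K_stabilizing[OF l]]
        cost_K_eq_quad_P[OF l]
      by (intro diff_right_mono sum_mono quad_P_le_cost l)
  qed
  then show "D l = (\<Sum>j\<in>UNIV. quad (P l) (axis j 1)) - l \<bullet> c"
    by (simp add: lagrangian_eq_sum_cost[OF K_stabilizing[OF l]] cost_K_eq_quad_P[OF l])
qed

lemma dual_function_has_derivative:
  assumes l: "l \<in> nonneg_orthant"
  defines "g \<equiv> (\<chi> i. lqr_cost M x0 A B (Q i) (R i) (K l) - c $ i)"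
  shows "(D has_derivative (\<lambda>h. g \<bullet> h)) (at l within nonneg_orthant)"
  unfolding has_derivative_within_alt
proof (intro conjI allI impI)
  show "bounded_linear (\<lambda>h. g \<bullet> h)"
    by (rule bounded_linear_inner_right)
  have "\<forall>j. \<exists>C\<ge>0. \<forall>l'\<in>nonneg_orthant. norm (l' - l) \<le> 1 \<longrightarrow>
      cost A B (Qw l') (Rw l') (K l) (axis j 1) - quad (P l') (axis j 1) \<le> C * (norm (l' - l))\<^sup>2"
    by (intro allI cost_gap_quadratic l)
  then obtain C where C: "\<And>j. C j \<ge> 0"
    "\<And>j l'. l' \<in> nonneg_orthant \<Longrightarrow> norm (l' - l) \<le> 1 \<Longrightarrow>
      cost A B (Qw l') (Rw l') (K l) (axis j 1) - quad (P l') (axis j 1) \<le> C j * (norm (l' - l))\<^sup>2"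
    by metis
  have remainder: "norm (D l' - D l - g \<bullet> (l' - l)) \<le> sum C UNIV * (norm (l' - l))\<^sup>2"
    if l': "l' \<in> nonneg_orthant" and le1: "norm (l' - l) \<le> 1" for l'
  proof -
    have "Lag (K l) l' = D l + g \<bullet> (l' - l)"
      unfolding dual_function_eq_lagrangian[OF l]
      by (simp add: lagrangian_def g_def inner_vec_def algebra_simps sum.distrib sum_subtractf)
    then have "D l' - D l - g \<bullet> (l' - l) = D l' - Lag (K l) l'"
      by simp
    also have "\<dots> = - (\<Sum>j\<in>UNIV. cost A B (Qw l') (Rw l') (K l) (axis j 1) - quad (P l') (axis j 1))"
      unfolding dual_function_eq_quad[OF l'] lagrangian_eq_sum_cost[OF K_stabilizing[OF l]]
      by (simp add: sum_subtractf)
    finally have eq: "norm (D l' - D l - g \<bullet> (l' - l)) =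
        \<bar>\<Sum>j\<in>UNIV. cost A B (Qw l') (Rw l') (K l) (axis j 1) - quad (P l') (axis j 1)\<bar>"
      by simp
    \<comment> \<open>Optimality at \<open>l'\<close> fixes the sign of the remainder, so an upper
      bound for the gap also bounds its absolute value.\<close>
    have "0 \<le> (\<Sum>j\<in>UNIV. cost A B (Qw l') (Rw l') (K l) (axis j 1) - quad (P l') (axis j 1))"
      using quad_P_le_cost[OF l' K_stabilizing[OF l]] by (intro sum_nonneg) simp
    moreover have "(\<Sum>j\<in>UNIV. cost A B (Qw l') (Rw l') (K l) (axis j 1) - quad (P l') (axis j 1))
        \<le> (\<Sum>j\<in>UNIV. C j * (norm (l' - l))\<^sup>2)"
      by (intro sum_mono C l' le1)
    ultimately show ?thesis
      unfolding eq by (simp add: sum_distrib_right)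
  qed
  fix e :: real
  assume "e > 0"
  have pos: "sum C UNIV \<ge> 0"
    using C(1) by (simp add: sum_nonneg)
  \<comment> \<open>The 1 keeps \<open>l'\<close> where the quadratic bound holds; adding 1 to the
    denominator covers \<open>sum C UNIV = 0\<close>.\<close>
  let ?d = "min 1 (e / (sum C UNIV + 1))"
  have "norm (D l' - D l - g \<bullet> (l' - l)) \<le> e * norm (l' - l)"
    if l': "l' \<in> nonneg_orthant" and d: "norm (l' - l) < ?d" for l'
  proof -
    have "norm (l' - l) * (sum C UNIV + 1) \<le> e"
      using d pos by (simp add: pos_less_divide_eq)
    then have "sum C UNIV * norm (l' - l) \<le> e"
      using norm_ge_zero[of "l' - l"] by (simp add: distrib_left mult.commute del: norm_ge_zero)
    then have "sum C UNIV * (norm (l' - l))\<^sup>2 \<le> e * norm (l' - l)"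
      using mult_right_mono[OF _ norm_ge_zero] by (simp add: power2_eq_square mult.assoc[symmetric])
    then show ?thesis
      using remainder[OF l'] d by linarith
  qed
  moreover have "?d > 0"
    using pos \<open>e > 0\<close> by simp
  ultimately show "\<exists>d>0. \<forall>l'\<in>nonneg_orthant. norm (l' - l) < d \<longrightarrow>
      norm (D l' - D l - g \<bullet> (l' - l)) \<le> e * norm (l' - l)"
    by blast
qed

end

end

text \<open>At boundary points differentiability is relative to the orthant. As the orthant is
  convex with nonempty interior, such a derivative still determines its representing vector, the
  gradient.\<close>

theorem lemma3:
  fixes M :: "'w measure" and x0 :: "'w \<Rightarrow> real^'n"
    and A :: "real^'n^'n" and B :: "real^'m^'n"
    and Q0 :: "real^'n^'n" and R0 :: "real^'m^'m"
    and Q :: "'k::finite \<Rightarrow> real^'n^'n" and R :: "'k \<Rightarrow> real^'m^'m"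
    and c l :: "real^'k"
  assumes "controllable A B"
    and "prob_space M"
    and "has_bochner_integral M x0 0"
    and "has_bochner_integral M (\<lambda>\<omega>. \<chi> i j. x0 \<omega> $ i * x0 \<omega> $ j) (mat 1 :: real^'n^'n)"
    and "pos_def Q0" and "pos_def R0"
    and "\<And>i. pos_semidef (Q i)" and "\<And>i. pos_semidef (R i)"
    and "l \<in> nonneg_orthant"
  shows "(dual_function M x0 A B Q0 R0 Q R c has_derivative
           (\<lambda>h. (\<chi> i. lqr_cost M x0 A B (Q i) (R i) (optimal_gain A B Q0 R0 Q R l) - c $ i) \<bullet> h))
         (at l within nonneg_orthant)"
proof -
  interpret weighted_lqr A B Q0 R0 Q R
    by unfold_locales (use assms in auto)
  show ?thesis
    using assms(4,9) by (rule dual_function_has_derivative)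
qed

end
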